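(* Let $\{F_\theta:\theta\in\Theta\}$, $\Theta\subset\mathbb{R}$, be a family of distributions with support on $Z_0=\{0,1,2,\dots\}$ and probability densities (mass functions) $p(x,\theta)$, and let $\theta_1=\inf\Theta$, $\theta_2=\sup\Theta$. Assume: (A1) $F_\theta(x)$ is a strictly decreasing function of $\theta$ for all $x\in Z_0$; (A2) $F_\theta(x)$ is a continuous function of $\theta$ for all $x\in Z_0$; (A3) $\lim_{\theta\to\theta_1}F_\theta(x)=1$ for $x\neq0$, and $\lim_{\theta\to\theta_2}F_\theta(x)=0$ for all $x\in Z_0$. Let $x_1,\dots,x_n$ be a random sample of $F_\theta$, with empirical distribution $F_n$. Assume that the density $p(x,\theta)$ is continuously differentiable in $\theta$. Let $\widehat\theta_n$ be the estimator defined by $\mathrm{umed}(F_n)=\mathrm{umed}(F_{\widehat\theta_n})$. Let $$g(\theta)=k_0(F_\theta)-0.5+\frac{0.5-F_\theta(k_0(F_\theta)-1)}{p(k_0(F_\theta),\theta)}$$ and put $K=k_0(F_\theta)$. (a) If $F_\theta(K)>0.5$, then $$n^{1/2}(\widehat\theta_n-\theta)\to_d N\!\left(0,\frac{\sigma^2}{g'(\theta)^2}\right),$$ where, with $p_0=p(K,\theta)$ and $F^1=F_\theta(K-1)$, $$\sigma^2=\frac{0.25}{p_0^3}\bigl(4F^1(F^1-1+p_0)-p_0+1\bigr).$$ (b) If $F_\theta(K)=0.5$, then $n^{1/2}(\widehat\theta_n-\theta)\to_d G$, where $$G(t)=\begin{cases}\Phi\bigl(2g'_-\,t\,p(K,\theta)\bigr)&\text{if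 }t\le0,\\ \Phi\bigl(2g'_+\,t\,p(K+1,\theta)\bigr)&\text{if }t>0,\end{cases}$$ $\Phi$ is the standard normal distribution function, and $$g'_+=\frac{\partial}{\partial t}\left[\frac{0.5-F_t(K)}{p(K+1,t)}\right]_{t=\theta+},\qquad g'_-=\frac{\partial}{\partial t}\left[\frac{0.5-F_t(K-1)}{p(K,t)}\right]_{t=\theta-}.$$
   Context: For a distribution $F$ with support on $Z_0=\{0,1,2,\dots\}$ and probability mass function $p$ (with $F(-1)=0$), let $k_0(F)=\min\{k:F(k)\ge 0.5\}$. The uniform median of $F$ is the median of $x+u$, where $x\sim F$ and $u$ uniform on $[-0.5,0.5]$ are independent; explicitly $$\mathrm{umed}(F)=k_0(F)-0.5+\frac{0.5-F(k_0(F)-1)}{p(k_0(F))}.$$ Thus $g(\theta)=\mathrm{umed}(F_\theta)$. The empirical distribution $F_n$ has mass function $p_n(k)=\#\{i:x_i=k\}/n$. $\to_d$ denotes convergence in distribution; the subscripts $t=\theta+$ and $t=\theta-$ denote right and left derivatives at $\theta$.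
   Formalization: The true θ is taken in the interior of Θ (so the derivatives at θ make sense); (a) assumes g'(θ)≠0, since otherwise σ²/g'(θ)² is undefined; (b) assumes p(K+1,θ)≠0, since otherwise the quotient defining g'_+ is undefined at θ. *)

theory Defs
  imports "HOL-Probability.Probability"
begin

(* The argument is an integer so that the value at -1 is available and equal to 0. *)
definition dist_fun :: "nat pmf \<Rightarrow> int \<Rightarrow> real" where
  "dist_fun F k = measure_pmf.prob F {x. int x \<le> k}"

definition k0 :: "nat pmf \<Rightarrow> nat" where
  "k0 F = (LEAST k. dist_fun F (int k) \<ge> 1/2)"

(* The median of x + u for independent x distributed as F and u uniform on [-1/2, 1/2].
   The denominator never vanishes. If dist_fun F (k0 F) = 1/2 and F puts no mass on
   k0 F + 1, then x + u has an interval of medians and the formula picks its left end. *)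
definition umed :: "nat pmf \<Rightarrow> real" where
  "umed F = real (k0 F) - 1/2 + (1/2 - dist_fun F (int (k0 F) - 1)) / pmf F (k0 F)"

(* Meaningful for n > 0 only: pmf_of_set needs a nonempty set. *)
definition empirical :: "nat \<Rightarrow> (nat \<Rightarrow> nat) \<Rightarrow> nat pmf" where
  "empirical n x = map_pmf x (pmf_of_set {..<n})"

lemma pmf_empirical:
  assumes "n > 0"
  shows "pmf (empirical n x) k = real (card {i. i < n \<and> x i = k}) / real n"
proof -
  have "{..<n} \<inter> x -` {k} = {i. i < n \<and> x i = k}"
    by auto
  moreover have "{..<n} \<noteq> {}"
    using assms by auto
  ultimately show ?thesis
    by (simp add: empirical_def pmf_map measure_pmf_of_set)
qed

lemma dist_fun_minus_one: "dist_fun F (-1) = 0"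
  by (simp add: dist_fun_def)

lemma dist_fun_half: "\<exists>k. dist_fun F (int k) \<ge> 1/2"
proof -
  have "(\<lambda>k. measure_pmf.prob F {..k}) \<longlonglongrightarrow> measure_pmf.prob F (\<Union>k. {..k})"
    by (intro measure_pmf.finite_Lim_measure_incseq) (auto simp: incseq_def)
  moreover have "(\<Union>k::nat. {..k}) = UNIV"
    by auto
  ultimately have "(\<lambda>k. measure_pmf.prob F {..k}) \<longlonglongrightarrow> 1"
    by simp
  then have "\<forall>\<^sub>F k in sequentially. 1/2 < measure_pmf.prob F {..k}"
    by (rule order_tendstoD) simp
  then obtain k where "1/2 < measure_pmf.prob F {..k}"
    by (auto simp: eventually_sequentially)
  moreover have "{x. int x \<le> int k} = {..k}"
    by auto
  ultimately show ?thesis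
    by (intro exI[of _ k]) (simp add: dist_fun_def)
qed

lemma pmf_k0_pos: "pmf F (k0 F) > 0"
proof -
  have ge: "dist_fun F (int (k0 F)) \<ge> 1/2"
    unfolding k0_def using dist_fun_half by (rule LeastI_ex)
  have less: "dist_fun F (int (k0 F) - 1) < 1/2"
  proof (cases "k0 F")
    case 0
    then show ?thesis by (simp add: dist_fun_minus_one)
  next
    case (Suc j)
    then have "\<not> dist_fun F (int j) \<ge> 1/2"
      using not_less_Least[of j "\<lambda>k. dist_fun F (int k) \<ge> 1/2"] by (simp add: k0_def)
    then show ?thesis using Suc by simp
  qed
  have "{x. int x \<le> int (k0 F)} = {x. int x \<le> int (k0 F) - 1} \<union> {k0 F}"
    by auto
  then have "dist_fun F (int (k0 F)) = dist_fun F (int (k0 F) - 1) + pmf F (k0 F)"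
    unfolding dist_fun_def
    by (simp only:) (subst measure_pmf.finite_measure_Union, auto simp: measure_pmf_single)
  then show ?thesis using ge less by simp
qed

end

theory Submission
  imports Defs
begin

text \<open>
  Let \<open>H F = smooth_cdf F\<close> be the distribution function of \<open>x + u\<close>, which is the expectation of the ramp
  \<open>P(u \<le> y - x)\<close> under \<open>F\<close>. The uniform median is its smallest median: \<open>umed F \<le> y\<close> iff
  \<open>H F y \<ge> 1/2\<close>. As \<open>g\<close> is strictly increasing and is continuous near \<open>\<theta>\<close>, the event
  \<open>\<surd>n (T n - \<theta>) \<le> s\<close> agrees, up to events of vanishing probability, with
  \<open>H F\<^sub>n (y\<^sub>n) \<ge> 1/2\<close> for \<open>y\<^sub>n = g (\<theta> + s/\<surd>n)\<close>. Here \<open>H F\<^sub>n (y)\<close> is a mean of i.i.d. bounded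
  variables that is 1-Lipschitz in \<open>y\<close>, so by Chebyshev's inequality \<open>y\<^sub>n\<close> may be replaced by
  \<open>g \<theta>\<close> in the centred mean, to which the central limit theorem applies. What remains is the
  deterministic drift \<open>\<surd>n (H F\<^sub>\<theta> (y\<^sub>n) - 1/2)\<close>. Its limit is linear in \<open>s\<close> on each side of 0; in case (b) the point
  \<open>g \<theta>\<close> is the boundary of two cells, on which \<open>H F\<^sub>\<theta>\<close> has different slopes, and the sign of \<open>s\<close>
  decides which cell matters.
\<close>

section \<open>The smoothed distribution function\<close>

definition ramp :: "real \<Rightarrow> nat \<Rightarrow> real" where
  "ramp y x = max 0 (min 1 (y - real x + 1/2))"

definition smooth_cdf :: "nat pmf \<Rightarrow> real \<Rightarrow> real" where
  "smooth_cdf F y = measure_pmf.expectation F (ramp y)"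

lemma ramp_bounds: "0 \<le> ramp y x" "ramp y x \<le> 1"
  by (auto simp: ramp_def)

lemma abs_ramp_le: "\<bar>ramp y x\<bar> \<le> 1"
  using ramp_bounds[of y x] by simp

lemma ramp_mono: "y \<le> z \<Longrightarrow> ramp y x \<le> ramp z x"
  by (auto simp: ramp_def)

lemma ramp_lipschitz: "\<bar>ramp y x - ramp z x\<bar> \<le> \<bar>y - z\<bar>"
  by (auto simp: ramp_def max_def min_def)

lemma integrable_pmf_bounded:
  fixes f :: "nat \<Rightarrow> real"
  assumes "\<And>x. \<bar>f x\<bar> \<le> B"
  shows "integrable (measure_pmf F) f"
  by (rule measure_pmf.integrable_const_bound[where B = B]) (use assms in auto)

lemma integrable_ramp [simp]: "integrable (measure_pmf F) (ramp y)"
  by (rule integrable_pmf_bounded) (rule abs_ramp_le)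

lemma smooth_cdf_mono: "y \<le> z \<Longrightarrow> smooth_cdf F y \<le> smooth_cdf F z"
  unfolding smooth_cdf_def by (intro integral_mono integrable_ramp ramp_mono)

lemma smooth_cdf_lipschitz: "\<bar>smooth_cdf F y - smooth_cdf F z\<bar> \<le> \<bar>y - z\<bar>"
proof -
  have "smooth_cdf F y - smooth_cdf F z = measure_pmf.expectation F (\<lambda>x. ramp y x - ramp z x)"
    by (simp add: smooth_cdf_def)
  also have "\<bar>\<dots>\<bar> \<le> measure_pmf.expectation F (\<lambda>x. \<bar>ramp y x - ramp z x\<bar>)"
    by (rule integral_abs_bound)
  also have "\<dots> \<le> \<bar>y - z\<bar>"
    by (intro measure_pmf.integral_le_const integrable_abs Bochner_Integration.integrable_diff)
       (auto simp: ramp_lipschitz)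
  finally show ?thesis .
qed

lemma smooth_cdf_empirical:
  assumes "n > 0"
  shows "smooth_cdf (empirical n x) y = (\<Sum>i<n. ramp y (x i)) / real n"
proof -
  have "{..<n} \<noteq> {}" using assms by auto
  then show ?thesis
    by (simp add: smooth_cdf_def empirical_def integral_pmf_of_set)
qed

section \<open>Distribution function and first median index of a law on the naturals\<close>

lemma dist_fun_eq_sum: "dist_fun F k = (\<Sum>j | int j \<le> k. pmf F j)"
proof -
  have "{j. int j \<le> k} \<subseteq> {..nat k}" by auto
  then have "finite {j. int j \<le> k}" using finite_subset by blast
  then show ?thesis by (simp add: dist_fun_def measure_measure_pmf_finite)
qed

lemma dist_fun_le_1: "dist_fun F k \<le> 1"
  by (simp add: dist_fun_def)

lemma dist_fun_mono: "k \<le> l \<Longrightarrow> dist_fun F k \<le> dist_fun F l"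
  unfolding dist_fun_def by (intro measure_pmf.finite_measure_mono) auto

lemma dist_fun_step: "dist_fun F (int k) = dist_fun F (int k - 1) + pmf F k"
proof -
  have "{x. int x \<le> int k} = {x. int x \<le> int k - 1} \<union> {k}"
    by auto
  then show ?thesis
    unfolding dist_fun_def
    by (simp only:) (subst measure_pmf.finite_measure_Union, auto simp: measure_pmf_single)
qed

lemma k0_ge_half: "dist_fun F (int (k0 F)) \<ge> 1/2"
  unfolding k0_def using dist_fun_half by (rule LeastI_ex)

lemma k0_less_half: "dist_fun F (int (k0 F) - 1) < 1/2"
proof (cases "k0 F")
  case 0
  then show ?thesis by (simp add: dist_fun_minus_one)
next
  case (Suc j)
  then have "\<not> dist_fun F (int j) \<ge> 1/2"
    using not_less_Least[of j "\<lambda>k. dist_fun F (int k) \<ge> 1/2"] by (simp add: k0_def)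
  then show ?thesis using Suc by simp
qed

lemma k0_eqI:
  assumes "dist_fun F (int k - 1) < 1/2" "dist_fun F (int k) \<ge> 1/2"
  shows "k0 F = k"
  unfolding k0_def
proof (rule Least_equality)
  fix j assume j: "dist_fun F (int j) \<ge> 1/2"
  show "k \<le> j"
  proof (rule ccontr)
    assume "\<not> k \<le> j"
    then have "dist_fun F (int j) \<le> dist_fun F (int k - 1)"
      by (intro dist_fun_mono) auto
    with j assms show False by simp
  qed
qed (use assms in auto)

text \<open>On the cell of radius 1/2 around \<open>k\<close> the ramp is 1 at atoms below
  \<open>k\<close>, 0 at atoms above \<open>k\<close>, and varies only at \<open>k\<close>. Both end
  points are included, so that the formulas of neighbouring cells agree at their common
  boundary.\<close>

lemma smooth_cdf_on_cell:
  assumes "real k - 1/2 \<le> y" "y \<le> real k + 1/2"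
  shows "smooth_cdf F y = dist_fun F (int k - 1) + (y - real k + 1/2) * pmf F k"
proof -
  have eq: "ramp y = (\<lambda>x. indicator {x. int x \<le> int k - 1} x + (y - real k + 1/2) * indicator {k} x)"
  proof
    fix x :: nat
    consider "x < k" | "x = k" | "x > k" by linarith
    then show "ramp y x = indicator {x. int x \<le> int k - 1} x + (y - real k + 1/2) * indicator {k} x"
    proof cases
      case 1
      then have "real x \<le> real k - 1" by linarith
      then show ?thesis using 1 assms by (auto simp: ramp_def)
    next
      case 2
      then show ?thesis using assms by (auto simp: ramp_def)
    next
      case 3
      then have "real x \<ge> real k + 1" by linarith
      then show ?thesis using 3 assms by (auto simp: ramp_def)
    qed
  qed
  have "integrable (measure_pmf F) (\<lambda>x. indicator {x. int x \<le> int k - 1} x :: real)"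
       "integrable (measure_pmf F) (\<lambda>x. (y - real k + 1/2) * indicator {k} x)"
    by (rule integrable_pmf_bounded[where B = 1], simp add: indicator_def)
       (rule integrable_pmf_bounded[where B = "\<bar>y - real k + 1/2\<bar>"], simp add: indicator_def)
  then show ?thesis
    by (simp add: smooth_cdf_def eq dist_fun_def measure_pmf_single)
qed

section \<open>The uniform median as the smallest median of the smoothed law\<close>

lemma umed_cell: "real (k0 F) - 1/2 < umed F" "umed F \<le> real (k0 F) + 1/2"
  using pmf_k0_pos[of F] k0_ge_half[of F] k0_less_half[of F] dist_fun_step[of F "k0 F"]
  by (auto simp: umed_def field_simps)

lemma smooth_cdf_umed: "smooth_cdf F (umed F) = 1/2"
  using pmf_k0_pos[of F] smooth_cdf_on_cell[of "k0 F" "umed F" F] umed_cell[of F]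
  by (auto simp: umed_def)

text \<open>On its cell \<open>smooth_cdf\<close> is affine with slope
  \<open>pmf F (k0 F) > 0\<close>, hence strictly below 1/2 to the left of the median. A point below
  the cell is first raised to the left end of the cell, which monotonicity permits and which is
  still strictly below the median.\<close>

lemma smooth_cdf_less_half:
  assumes "y < umed F"
  shows "smooth_cdf F y < 1/2"
proof -
  let ?z = "max y (real (k0 F) - 1/2)"
  have z: "real (k0 F) - 1/2 \<le> ?z" "?z \<le> real (k0 F) + 1/2" "?z < umed F"
    using assms umed_cell[of F] by auto
  have "smooth_cdf F y \<le> smooth_cdf F ?z"
    by (rule smooth_cdf_mono) simp
  also have "\<dots> < dist_fun F (int (k0 F) - 1) + (umed F - real (k0 F) + 1/2) * pmf F (k0 F)"
    unfolding smooth_cdf_on_cell[OF z(1,2)] using z(3) pmf_k0_pos[of F] by simp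
  also have "\<dots> = 1/2"
    using smooth_cdf_umed[of F] smooth_cdf_on_cell[of "k0 F" "umed F" F] umed_cell[of F] by simp
  finally show ?thesis .
qed

text \<open>This turns events about an implicitly defined median into events about a sample mean. It
  is an equivalence because \<open>umed\<close> picks the left end when there is an interval of
  medians.\<close>

lemma umed_le_iff: "umed F \<le> y \<longleftrightarrow> 1/2 \<le> smooth_cdf F y"
  using smooth_cdf_less_half[of y F] smooth_cdf_mono[of "umed F" y F] smooth_cdf_umed[of F]
  by (cases "umed F \<le> y") auto

text \<open>At \<open>umed F\<close>, which lies in the cell of \<open>k\<close>, every smoothed
  distribution function is the same convex combination of its unsmoothed values at
  \<open>k - 1\<close> and \<open>k\<close>. The weight \<open>l\<close> at \<open>k\<close> is
  positive, so the strict inequality there survives.\<close>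

lemma umed_strict_mono:
  assumes "\<And>x::nat. dist_fun G (int x) < dist_fun F (int x)"
  shows "umed F < umed G"
proof -
  define k where "k = k0 F"
  define l where "l = umed F - real k + 1/2"
  have cell: "real k - 1/2 \<le> umed F" "umed F \<le> real k + 1/2"
    and l: "0 < l" "l \<le> 1"
    using umed_cell[of F] by (auto simp: k_def l_def)
  have split: "smooth_cdf H (umed F) = (1 - l) * dist_fun H (int k - 1) + l * dist_fun H (int k)" for H
    using smooth_cdf_on_cell[OF cell, of H] by (simp add: l_def dist_fun_step[of H k] algebra_simps)
  \<comment> \<open>Only a weak inequality is available here: for \<open>k = 0\<close> both sides
    vanish.\<close>
  have "dist_fun G (int k - 1) \<le> dist_fun F (int k - 1)"
    using assms[of "k - 1"] by (cases k) (auto simp: dist_fun_minus_one)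
  then have "(1 - l) * dist_fun G (int k - 1) \<le> (1 - l) * dist_fun F (int k - 1)"
    using l by (intro mult_left_mono) auto
  moreover have "l * dist_fun G (int k) < l * dist_fun F (int k)"
    using l assms[of k] by simp
  ultimately have "smooth_cdf G (umed F) < 1/2"
    using split[of F] split[of G] smooth_cdf_umed[of F] by linarith
  then show ?thesis
    using umed_le_iff[of G "umed F"] by linarith
qed

lemma smooth_cdf_bounds: "0 \<le> smooth_cdf F y" "smooth_cdf F y \<le> 1"
  unfolding smooth_cdf_def
  by (auto intro!: integral_nonneg measure_pmf.integral_le_const simp: ramp_bounds)

text \<open>Off \<open>k\<close> the ramp is 0 or 1, so the square is 1/4; at \<open>k\<close> it is
  1/4 minus \<open>l * (1 - l)\<close>. At \<open>y = umed F\<close>, where the mean of the ramp is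
  1/2, this is the variance in the central limit theorem.\<close>

lemma expectation_ramp_square:
  assumes "real k - 1/2 \<le> y" "y \<le> real k + 1/2"
  shows "measure_pmf.expectation F (\<lambda>x. (ramp y x - 1/2)\<^sup>2)
    = 1/4 - (y - real k + 1/2) * (1/2 + real k - y) * pmf F k"
proof -
  define l where "l = y - real k + 1/2"
  have eq: "(\<lambda>x. (ramp y x - 1/2)\<^sup>2) = (\<lambda>x. 1/4 - l * (1 - l) * indicator {k} x)"
  proof
    fix x :: nat
    consider "x < k" | "x = k" | "x > k" by linarith
    then show "(ramp y x - 1/2)\<^sup>2 = 1/4 - l * (1 - l) * indicator {k} x"
    proof cases
      case 1
      then have "real x \<le> real k - 1" by linarith
      then have "ramp y x = 1" using assms by (auto simp: ramp_def)
      then show ?thesis using 1 by (simp add: power2_eq_square)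
    next
      case 2
      then have "ramp y x = l" using assms by (auto simp: ramp_def l_def)
      then show ?thesis using 2 by (simp add: power2_eq_square algebra_simps)
    next
      case 3
      then have "real x \<ge> real k + 1" by linarith
      then have "ramp y x = 0" using assms by (auto simp: ramp_def)
      then show ?thesis using 3 by (simp add: power2_eq_square)
    qed
  qed
  have "integrable (measure_pmf F) (\<lambda>x. l * (1 - l) * indicator {k} x)"
    by (rule integrable_pmf_bounded[where B = "\<bar>l * (1 - l)\<bar>"]) (simp add: indicator_def)
  then have "measure_pmf.expectation F (\<lambda>x. (ramp y x - 1/2)\<^sup>2) = 1/4 - l * (1 - l) * pmf F k"
    by (simp add: eq measure_pmf_single)
  then show ?thesis by (simp add: l_def)
qed

section \<open>Limit theorems for the empirical median\<close>

text \<open>A Slutsky argument: moving the threshold from \<open>c\<close> by \<epsilon> costs at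
  most the probability that \<open>U n\<close> and \<open>V n\<close> differ by \<epsilon>, and
  continuity at \<open>c\<close> makes the shift harmless. Only the one threshold \<open>c\<close>
  is treated for \<open>V\<close>, because later \<open>V\<close> itself depends on it.\<close>

lemma (in prob_space) tendsto_prob_le_of_close:
  fixes U V :: "nat \<Rightarrow> 'a \<Rightarrow> real"
  assumes U [measurable]: "\<And>n. random_variable borel (U n)"
    and V [measurable]: "\<And>n. random_variable borel (V n)"
    and lim: "\<And>x. (\<lambda>n. prob {\<omega> \<in> space M. U n \<omega> \<le> x}) \<longlonglongrightarrow> F x"
    and cont: "isCont F c"
    and close: "\<And>\<epsilon>. \<epsilon> > 0 \<Longrightarrow> (\<lambda>n. prob {\<omega> \<in> space M. \<epsilon> \<le> \<bar>U n \<omega> - V n \<omega>\<bar>}) \<longlonglongrightarrow> 0"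
  shows "(\<lambda>n. prob {\<omega> \<in> space M. V n \<omega> \<le> c}) \<longlonglongrightarrow> F c"
proof (rule order_tendstoI)
  fix a assume "a < F c"
  then have "\<forall>\<^sub>F x in at c. a < F x"
    using cont by (auto simp: isCont_def intro: order_tendstoD)
  then obtain d where d: "d > 0" "\<And>x. x \<noteq> c \<Longrightarrow> dist x c < d \<Longrightarrow> a < F x"
    by (auto simp: eventually_at)
  define \<epsilon> where "\<epsilon> = d / 2"
  have \<epsilon>: "\<epsilon> > 0" "a < F (c - \<epsilon>)"
    using d by (auto simp: \<epsilon>_def dist_real_def)
  have "(\<lambda>n. prob {\<omega> \<in> space M. U n \<omega> \<le> c - \<epsilon>} - prob {\<omega> \<in> space M. \<epsilon> \<le> \<bar>U n \<omega> - V n \<omega>\<bar>})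
      \<longlonglongrightarrow> F (c - \<epsilon>) - 0"
    by (intro tendsto_diff lim close \<epsilon>)
  then have "\<forall>\<^sub>F n in sequentially. a < prob {\<omega> \<in> space M. U n \<omega> \<le> c - \<epsilon>}
      - prob {\<omega> \<in> space M. \<epsilon> \<le> \<bar>U n \<omega> - V n \<omega>\<bar>}"
    by (rule order_tendstoD) (use \<epsilon> in simp)
  then show "\<forall>\<^sub>F n in sequentially. a < prob {\<omega> \<in> space M. V n \<omega> \<le> c}"
  proof eventually_elim
    case (elim n)
    have "prob {\<omega> \<in> space M. U n \<omega> \<le> c - \<epsilon>}
        \<le> prob ({\<omega> \<in> space M. V n \<omega> \<le> c} \<union> {\<omega> \<in> space M. \<epsilon> \<le> \<bar>U n \<omega> - V n \<omega>\<bar>})"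
      by (intro finite_measure_mono) auto
    also have "\<dots> \<le> prob {\<omega> \<in> space M. V n \<omega> \<le> c} + prob {\<omega> \<in> space M. \<epsilon> \<le> \<bar>U n \<omega> - V n \<omega>\<bar>}"
      by (intro measure_Un_le) auto
    finally show ?case using elim by simp
  qed
next
  fix a assume "F c < a"
  then have "\<forall>\<^sub>F x in at c. F x < a"
    using cont by (auto simp: isCont_def intro: order_tendstoD)
  then obtain d where d: "d > 0" "\<And>x. x \<noteq> c \<Longrightarrow> dist x c < d \<Longrightarrow> F x < a"
    by (auto simp: eventually_at)
  define \<epsilon> where "\<epsilon> = d / 2"
  have \<epsilon>: "\<epsilon> > 0" "F (c + \<epsilon>) < a"
    using d by (auto simp: \<epsilon>_def dist_real_def)
  have "(\<lambda>n. prob {\<omega> \<in> space M. U n \<omega> \<le> c + \<epsilon>} + prob {\<omega> \<in> space M. \<epsilon> \<le> \<bar>U n \<omega> - V n \<omega>\<bar>})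
      \<longlonglongrightarrow> F (c + \<epsilon>) + 0"
    by (intro tendsto_add lim close \<epsilon>)
  then have "\<forall>\<^sub>F n in sequentially. prob {\<omega> \<in> space M. U n \<omega> \<le> c + \<epsilon>}
      + prob {\<omega> \<in> space M. \<epsilon> \<le> \<bar>U n \<omega> - V n \<omega>\<bar>} < a"
    by (rule order_tendstoD) (use \<epsilon> in simp)
  then show "\<forall>\<^sub>F n in sequentially. prob {\<omega> \<in> space M. V n \<omega> \<le> c} < a"
  proof eventually_elim
    case (elim n)
    have "prob {\<omega> \<in> space M. V n \<omega> \<le> c}
        \<le> prob ({\<omega> \<in> space M. U n \<omega> \<le> c + \<epsilon>} \<union> {\<omega> \<in> space M. \<epsilon> \<le> \<bar>U n \<omega> - V n \<omega>\<bar>})"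
      by (intro finite_measure_mono) auto
    also have "\<dots> \<le> prob {\<omega> \<in> space M. U n \<omega> \<le> c + \<epsilon>} + prob {\<omega> \<in> space M. \<epsilon> \<le> \<bar>U n \<omega> - V n \<omega>\<bar>}"
      by (intro measure_Un_le) auto
    finally show ?case using elim by simp
  qed
qed

section \<open>The normal distribution function and its scaling\<close>

lemma isCont_cdf_std_normal: "isCont (cdf std_normal_distribution) x"
proof -
  interpret real_distribution std_normal_distribution by (rule real_dist_normal_dist)
  have "emeasure std_normal_distribution {x} = 0"
    by (subst emeasure_density) (auto simp: nn_integral_indicator_singleton)
  then show ?thesis
    unfolding isCont_cdf by (simp add: measure_def)
qed

lemma cdf_centered_normal:
  assumes "s > 0"
  shows "cdf (density lborel (normal_density 0 s)) x = cdf std_normal_distribution (x / s)"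
proof -
  interpret N: prob_space std_normal_distribution by (rule prob_space_normal_density) simp
  have "distributed std_normal_distribution lborel (\<lambda>x. x) (normal_density 0 1)"
    by (simp add: distributed_def distr_id2)
  then have "distributed std_normal_distribution lborel (\<lambda>x. 0 + s * x) (normal_density (0 + s * 0) (\<bar>s\<bar> * 1))"
    by (rule N.normal_density_affine) (use assms in auto)
  then have eq: "distr std_normal_distribution lborel (\<lambda>x. s * x) = density lborel (normal_density 0 s)"
    using assms by (simp add: distributed_def)
  have "cdf (density lborel (normal_density 0 s)) x
      = measure std_normal_distribution ((\<lambda>x. s * x) -` {..x} \<inter> space std_normal_distribution)"
    unfolding eq[symmetric] cdf_def by (rule measure_distr) auto
  also have "(\<lambda>x. s * x) -` {..x} \<inter> space std_normal_distribution = {..x / s}"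
    using assms by (auto simp: field_simps)
  finally show ?thesis by (simp add: cdf_def)
qed

section \<open>Moment bounds and the central limit theorem for bounded functions of the
  sample\<close>

locale iid_nat_sample = prob_space M for M :: "'a measure" +
  fixes X :: "nat \<Rightarrow> 'a \<Rightarrow> nat" and F :: "nat pmf"
  assumes indep: "indep_vars (\<lambda>_. count_space UNIV) X UNIV"
    and distr_X: "\<And>i. distr M (count_space UNIV) (X i) = measure_pmf F"
begin

lemma X_measurable [measurable]: "X i \<in> measurable M (count_space UNIV)"
  using indep by (simp add: indep_vars_def)

lemma expectation_comp_X: "expectation (\<lambda>\<omega>. f (X i \<omega>)) = measure_pmf.expectation F f"
  for f :: "nat \<Rightarrow> real"
  unfolding distr_X[of i, symmetric] by (subst integral_distr) auto

lemma integrable_comp_X: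
  fixes f :: "nat \<Rightarrow> real"
  assumes "\<And>x. \<bar>f x\<bar> \<le> B"
  shows "integrable M (\<lambda>\<omega>. f (X i \<omega>))"
  by (rule integrable_const_bound[where B = B]) (use assms in auto)

lemma indep_comp_X: "indep_vars (\<lambda>_. borel) (\<lambda>i \<omega>. (f (X i \<omega>) :: real)) I"
  by (rule indep_vars_subset[of _ _ UNIV])
     (use indep in \<open>auto intro: indep_vars_compose2[where Y = "\<lambda>_. f"]\<close>)

text \<open>Induction on \<open>n\<close>: the new summand is independent of the preceding sum and
  has mean 0, so the cross term has expectation 0.\<close>

lemma
  fixes f :: "nat \<Rightarrow> real"
  assumes B: "\<And>x. \<bar>f x\<bar> \<le> B" and mean: "measure_pmf.expectation F f = 0"
  shows integrable_sum_square: "integrable M (\<lambda>\<omega>. (\<Sum>i<n. f (X i \<omega>))\<^sup>2)"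
    and expectation_sum_square: "expectation (\<lambda>\<omega>. (\<Sum>i<n. f (X i \<omega>))\<^sup>2)
      = real n * measure_pmf.expectation F (\<lambda>x. (f x)\<^sup>2)"
proof -
  have bound: "\<bar>(\<Sum>i<n. f (X i \<omega>))\<bar> \<le> real n * B" for n \<omega>
  proof -
    have "(\<Sum>i<n. \<bar>f (X i \<omega>)\<bar>) \<le> real n * B"
      using sum_bounded_above[of "{..<n}" "\<lambda>i. \<bar>f (X i \<omega>)\<bar>" B] B by simp
    then show ?thesis by (rule order_trans[OF sum_abs])
  qed
  have sum_int: "integrable M (\<lambda>\<omega>. \<Sum>i<n. f (X i \<omega>))" for n
    by (rule Bochner_Integration.integrable_sum, rule integrable_comp_X, rule B)
  have sq_le: "\<bar>(f x)\<^sup>2\<bar> \<le> B\<^sup>2" for x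
    using B[of x] by (simp add: abs_le_square_iff power2_le_iff_abs_le order_trans[OF abs_ge_zero])
  have sqi: "integrable M (\<lambda>\<omega>. (\<Sum>i<n. f (X i \<omega>))\<^sup>2)" for n
    by (rule integrable_const_bound[where B = "(real n * B)\<^sup>2"])
       (use bound[of _ n] in \<open>auto intro!: AE_I2 simp: abs_le_square_iff[symmetric] intro: order_trans[OF _ abs_ge_self]\<close>)
  show "integrable M (\<lambda>\<omega>. (\<Sum>i<n. f (X i \<omega>))\<^sup>2)" by (rule sqi)
  show "expectation (\<lambda>\<omega>. (\<Sum>i<n. f (X i \<omega>))\<^sup>2) = real n * measure_pmf.expectation F (\<lambda>x. (f x)\<^sup>2)"
  proof (induction n)
    case 0
    then show ?case by simp
  next
    case (Suc n)
    have iv: "indep_var borel (\<lambda>\<omega>. f (X n \<omega>)) borel (\<lambda>\<omega>. \<Sum>i<n. f (X i \<omega>))"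
      by (rule indep_vars_sum) (auto intro: indep_comp_X)
    have fi: "integrable M (\<lambda>\<omega>. f (X n \<omega>))" "integrable M (\<lambda>\<omega>. (f (X n \<omega>))\<^sup>2)"
      by (auto intro!: integrable_comp_X[where f = f] B integrable_comp_X[where f = "\<lambda>x. (f x)\<^sup>2"] sq_le)
    have pi: "integrable M (\<lambda>\<omega>. f (X n \<omega>) * (\<Sum>i<n. f (X i \<omega>)))"
      by (rule indep_var_integrable[OF iv fi(1) sum_int])
    have p0: "expectation (\<lambda>\<omega>. f (X n \<omega>) * (\<Sum>i<n. f (X i \<omega>))) = 0"
      by (subst indep_var_lebesgue_integral[OF iv fi(1) sum_int])
         (simp add: expectation_comp_X mean)
    have "expectation (\<lambda>\<omega>. (\<Sum>i<Suc n. f (X i \<omega>))\<^sup>2)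
        = expectation (\<lambda>\<omega>. (\<Sum>i<n. f (X i \<omega>))\<^sup>2 + 2 * (f (X n \<omega>) * (\<Sum>i<n. f (X i \<omega>))) + (f (X n \<omega>))\<^sup>2)"
      by (rule Bochner_Integration.integral_cong) (auto simp: power2_eq_square algebra_simps)
    also have "\<dots> = expectation (\<lambda>\<omega>. (\<Sum>i<n. f (X i \<omega>))\<^sup>2)
        + 2 * expectation (\<lambda>\<omega>. f (X n \<omega>) * (\<Sum>i<n. f (X i \<omega>))) + expectation (\<lambda>\<omega>. (f (X n \<omega>))\<^sup>2)"
      using sqi[of n] pi fi by simp
    finally show ?case
      by (simp add: Suc p0 expectation_comp_X[of "\<lambda>x. (f x)\<^sup>2"] algebra_simps)
  qed
qed

text \<open>Chebyshev's inequality with the second moment of \<open>f\<close> replaced by the square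
  of its bound. The explicit dependence on \<open>B\<close> matters: in the main limit
  \<open>f\<close> changes with \<open>n\<close> and its bound tends to 0.\<close>

lemma prob_sum_ge:
  fixes f :: "nat \<Rightarrow> real"
  assumes B: "\<And>x. \<bar>f x\<bar> \<le> B" and mean: "measure_pmf.expectation F f = 0" and "\<epsilon> > 0"
  shows "prob {\<omega> \<in> space M. \<epsilon> \<le> \<bar>\<Sum>i<n. f (X i \<omega>)\<bar>} \<le> real n * B\<^sup>2 / \<epsilon>\<^sup>2"
proof -
  have sq_le: "(f x)\<^sup>2 \<le> B\<^sup>2" for x
    using B[of x] by (simp add: power2_le_iff_abs_le order_trans[OF abs_ge_zero])
  have "measure_pmf.expectation F (\<lambda>x. (f x)\<^sup>2) \<le> B\<^sup>2"
    by (intro measure_pmf.integral_le_const integrable_pmf_bounded[where B = "B\<^sup>2"]) (auto simp: sq_le)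
  then have "real n * measure_pmf.expectation F (\<lambda>x. (f x)\<^sup>2) / \<epsilon>\<^sup>2 \<le> real n * B\<^sup>2 / \<epsilon>\<^sup>2"
    by (intro divide_right_mono mult_left_mono) auto
  then show ?thesis
    using second_moment_method[of "\<lambda>\<omega>. \<Sum>i<n. f (X i \<omega>)" \<epsilon>] \<open>\<epsilon> > 0\<close>
      integrable_sum_square[OF B mean, of n] expectation_sum_square[OF B mean, of n] by simp
qed

lemma tendsto_prob_normalized_sum:
  fixes f :: "nat \<Rightarrow> real"
  assumes B: "\<And>x. \<bar>f x\<bar> \<le> B" and mean: "measure_pmf.expectation F f = 0"
    and v: "measure_pmf.expectation F (\<lambda>x. (f x)\<^sup>2) = v" "v > 0"
  shows "(\<lambda>n. prob {\<omega> \<in> space M. (\<Sum>i<n. f (X i \<omega>)) / sqrt (real n) \<le> x})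
      \<longlonglongrightarrow> cdf std_normal_distribution (x / sqrt v)"
proof -
  have sq_le: "\<bar>(f x)\<^sup>2\<bar> \<le> B\<^sup>2" for x
    using B[of x] by (simp add: abs_le_square_iff power2_le_iff_abs_le order_trans[OF abs_ge_zero])
  have sqi: "integrable M (\<lambda>\<omega>. (f (X i \<omega>))\<^sup>2)" for i
    by (rule integrable_comp_X[where f = "\<lambda>x. (f x)\<^sup>2"]) (rule sq_le)
  have d: "distr M borel (\<lambda>\<omega>. f (X i \<omega>)) = distr (measure_pmf F) borel f" for i
    unfolding distr_X[of i, symmetric] by (subst distr_distr) (auto simp: comp_def)
  have "weak_conv_m (\<lambda>n. distr M borel (\<lambda>\<omega>. (\<Sum>i<n. f (X i \<omega>)) / sqrt (real n * (sqrt v)\<^sup>2)))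
      std_normal_distribution"
    by (rule central_limit_theorem_zero_mean[where \<mu> = "distr (measure_pmf F) borel f"])
       (use v sqi in \<open>auto simp: d expectation_comp_X mean expectation_comp_X[of "\<lambda>x. (f x)\<^sup>2"]
          intro: indep_comp_X\<close>)
  then have "(\<lambda>n. cdf (distr M borel (\<lambda>\<omega>. (\<Sum>i<n. f (X i \<omega>)) / sqrt (real n * v))) (x / sqrt v))
      \<longlonglongrightarrow> cdf std_normal_distribution (x / sqrt v)"
    using v isCont_cdf_std_normal by (auto simp: weak_conv_m_def weak_conv_def)
  moreover have "cdf (distr M borel (\<lambda>\<omega>. (\<Sum>i<n. f (X i \<omega>)) / sqrt (real n * v))) (x / sqrt v)
      = prob {\<omega> \<in> space M. (\<Sum>i<n. f (X i \<omega>)) / sqrt (real n) \<le> x}" for n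
    unfolding cdf_def
    by (subst measure_distr, simp_all, rule arg_cong[of _ _ prob])
       (use v in \<open>auto simp: real_sqrt_mult divide_simps\<close>)
  ultimately show ?thesis by simp
qed

section \<open>Convergence of the empirical uniform median\<close>

lemma smooth_cdf_empirical_measurable [measurable]:
  "(\<lambda>\<omega>. smooth_cdf (empirical n (\<lambda>i. X i \<omega>)) y) \<in> borel_measurable M"
proof -
  have "(\<lambda>p. ramp y (X (snd p) (fst p))) \<in> borel_measurable (M \<Otimes>\<^sub>M measure_pmf (pmf_of_set {..<n}))"
    by (rule measurable_compose_countable[where f = "\<lambda>i p. ramp y (X i (fst p))" and g = snd]) auto
  then have "(\<lambda>\<omega>. \<integral>i. ramp y (X i \<omega>) \<partial>measure_pmf (pmf_of_set {..<n})) \<in> borel_measurable M"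
    by (intro measure_pmf.borel_measurable_lebesgue_integral) (simp add: case_prod_beta')
  then show ?thesis
    by (simp add: smooth_cdf_def empirical_def)
qed

text \<open>The weak law of large numbers at a fixed \<open>y\<close>: Chebyshev's inequality for
  the centred ramp, which is bounded by 1.\<close>

lemma prob_smooth_cdf_empirical_far:
  assumes "\<epsilon> > 0"
  shows "(\<lambda>n. prob {\<omega> \<in> space M. \<epsilon> \<le> \<bar>smooth_cdf (empirical n (\<lambda>i. X i \<omega>)) y - smooth_cdf F y\<bar>})
    \<longlonglongrightarrow> 0"
proof (rule tendsto_sandwich[where f = "\<lambda>_. 0"])
  show "(\<lambda>n. 1 / (\<epsilon>\<^sup>2 * real n)) \<longlonglongrightarrow> 0"
    using assms by real_asymp
  show "\<forall>\<^sub>F n in sequentially. prob {\<omega> \<in> space M.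
      \<epsilon> \<le> \<bar>smooth_cdf (empirical n (\<lambda>i. X i \<omega>)) y - smooth_cdf F y\<bar>} \<le> 1 / (\<epsilon>\<^sup>2 * real n)"
    using eventually_gt_at_top[of 0]
  proof eventually_elim
    case (elim n)
    define f where "f x = ramp y x - smooth_cdf F y" for x
    have B: "\<bar>f x\<bar> \<le> 1" for x
      using ramp_bounds[of y x] smooth_cdf_bounds[of F y] by (auto simp: f_def)
    have mean: "measure_pmf.expectation F f = 0"
      by (simp add: f_def[abs_def] smooth_cdf_def)
    have "smooth_cdf (empirical n (\<lambda>i. X i \<omega>)) y - smooth_cdf F y = (\<Sum>i<n. f (X i \<omega>)) / real n" for \<omega>
      using elim by (simp add: smooth_cdf_empirical f_def sum_subtractf field_simps)
    then have "{\<omega> \<in> space M. \<epsilon> \<le> \<bar>smooth_cdf (empirical n (\<lambda>i. X i \<omega>)) y - smooth_cdf F y\<bar>}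
        = {\<omega> \<in> space M. \<epsilon> * real n \<le> \<bar>\<Sum>i<n. f (X i \<omega>)\<bar>}"
      using elim by (simp add: pos_le_divide_eq)
    also have "prob \<dots> \<le> real n * 1\<^sup>2 / (\<epsilon> * real n)\<^sup>2"
      by (rule prob_sum_ge[OF B mean]) (use elim assms in auto)
    also have "\<dots> = 1 / (\<epsilon>\<^sup>2 * real n)"
      using elim by (simp add: power2_eq_square field_simps)
    finally show ?case .
  qed
qed (auto intro: always_eventually)

text \<open>On this event the empirical smoothed distribution function at \<open>y\<close> is at
  least 1/2, so it misses its mean by a fixed positive amount.\<close>

lemma prob_umed_empirical_le_tendsto_0:
  assumes "smooth_cdf F y < 1/2"
  shows "(\<lambda>n. prob {\<omega> \<in> space M. umed (empirical n (\<lambda>i. X i \<omega>)) \<le> y}) \<longlonglongrightarrow> 0"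
proof (rule tendsto_sandwich[where f = "\<lambda>_. 0"])
  show "(\<lambda>n. prob {\<omega> \<in> space M. 1/2 - smooth_cdf F y \<le>
      \<bar>smooth_cdf (empirical n (\<lambda>i. X i \<omega>)) y - smooth_cdf F y\<bar>}) \<longlonglongrightarrow> 0"
    by (rule prob_smooth_cdf_empirical_far) (use assms in simp)
  show "\<forall>\<^sub>F n in sequentially. prob {\<omega> \<in> space M. umed (empirical n (\<lambda>i. X i \<omega>)) \<le> y}
      \<le> prob {\<omega> \<in> space M. 1/2 - smooth_cdf F y \<le>
        \<bar>smooth_cdf (empirical n (\<lambda>i. X i \<omega>)) y - smooth_cdf F y\<bar>}"
    by (intro always_eventually allI finite_measure_mono) (auto simp: umed_le_iff)
qed auto

lemma prob_umed_empirical_gt_tendsto_0: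
  assumes "1/2 < smooth_cdf F y"
  shows "(\<lambda>n. prob {\<omega> \<in> space M. y < umed (empirical n (\<lambda>i. X i \<omega>))}) \<longlonglongrightarrow> 0"
proof (rule tendsto_sandwich[where f = "\<lambda>_. 0"])
  show "(\<lambda>n. prob {\<omega> \<in> space M. smooth_cdf F y - 1/2 \<le>
      \<bar>smooth_cdf (empirical n (\<lambda>i. X i \<omega>)) y - smooth_cdf F y\<bar>}) \<longlonglongrightarrow> 0"
    by (rule prob_smooth_cdf_empirical_far) (use assms in simp)
  show "\<forall>\<^sub>F n in sequentially. prob {\<omega> \<in> space M. y < umed (empirical n (\<lambda>i. X i \<omega>))}
      \<le> prob {\<omega> \<in> space M. smooth_cdf F y - 1/2 \<le>
        \<bar>smooth_cdf (empirical n (\<lambda>i. X i \<omega>)) y - smooth_cdf F y\<bar>}"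
    by (intro always_eventually allI finite_measure_mono) (auto simp: umed_le_iff not_le[symmetric])
qed auto

text \<open>The moving point \<open>y n\<close> enters in two ways: through the drift, whose limit
  is the hypothesis on \<open>c\<close>, and through the fluctuation, which differs negligibly from
  that at \<open>y0\<close> because its summands differ by a multiple of the distance from
  \<open>y n\<close> to \<open>y0\<close>.\<close>

lemma prob_umed_empirical_le_tendsto_normal:
  assumes half: "smooth_cdf F y0 = 1/2" and y: "y \<longlonglongrightarrow> y0"
    and lim: "(\<lambda>n. sqrt (real n) * (smooth_cdf F (y n) - 1/2)) \<longlonglongrightarrow> c"
    and v: "measure_pmf.expectation F (\<lambda>x. (ramp y0 x - 1/2)\<^sup>2) = v" "v > 0"
  shows "(\<lambda>n. prob {\<omega> \<in> space M. umed (empirical n (\<lambda>i. X i \<omega>)) \<le> y n})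
    \<longlonglongrightarrow> cdf std_normal_distribution (c / sqrt v)"
proof -
  \<comment> \<open>\<open>U\<close> is the centred fluctuation at \<open>y0\<close>. In
    \<open>V\<close> the constant \<open>c\<close> is added so that, for positive \<open>n\<close>,
    \<open>V n \<omega> \<le> c\<close> says exactly that the empirical median is at most
    \<open>y n\<close>.\<close>
  define U where "U n \<omega> = (\<Sum>i<n. 1/2 - ramp y0 (X i \<omega>)) / sqrt (real n)" for n \<omega>
  define V where "V n \<omega> = (\<Sum>i<n. 1/2 - ramp (y n) (X i \<omega>)) / sqrt (real n) + c" for n \<omega>
  have [measurable]: "U n \<in> borel_measurable M" "V n \<in> borel_measurable M" for n
    unfolding U_def[abs_def] V_def[abs_def] by measurable
  have "(\<lambda>n. prob {\<omega> \<in> space M. V n \<omega> \<le> c}) \<longlonglongrightarrow> cdf std_normal_distribution (c / sqrt v)"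
  proof (rule tendsto_prob_le_of_close[where U = U and F = "\<lambda>x. cdf std_normal_distribution (x / sqrt v)"])
    show "(\<lambda>n. prob {\<omega> \<in> space M. U n \<omega> \<le> x}) \<longlonglongrightarrow> cdf std_normal_distribution (x / sqrt v)" for x
      unfolding U_def
    proof (rule tendsto_prob_normalized_sum[where f = "\<lambda>x. 1/2 - ramp y0 x" and B = 1])
      show "\<bar>1/2 - ramp y0 x\<bar> \<le> 1" for x
        using ramp_bounds[of y0 x] by auto
      show "measure_pmf.expectation F (\<lambda>x. 1/2 - ramp y0 x) = 0"
        using half by (simp add: smooth_cdf_def)
    qed (use v in \<open>auto simp: power2_commute\<close>)
    show "isCont (\<lambda>x. cdf std_normal_distribution (x / sqrt v)) c"
      using v by (intro isCont_o2[OF _ isCont_cdf_std_normal] continuous_intros) auto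
    show "(\<lambda>n. prob {\<omega> \<in> space M. \<epsilon> \<le> \<bar>U n \<omega> - V n \<omega>\<bar>}) \<longlonglongrightarrow> 0" if \<epsilon>: "\<epsilon> > 0" for \<epsilon>
    proof (rule tendsto_sandwich[where f = "\<lambda>_. 0"])
      have "(\<lambda>n. 16 * (y n - y0)\<^sup>2 / \<epsilon>\<^sup>2) \<longlonglongrightarrow> 16 * (y0 - y0)\<^sup>2 / \<epsilon>\<^sup>2"
        using \<epsilon> by (intro tendsto_intros y) auto
      then show "(\<lambda>n. 16 * (y n - y0)\<^sup>2 / \<epsilon>\<^sup>2) \<longlonglongrightarrow> 0" by simp
      have "\<forall>\<^sub>F n in sequentially. dist (sqrt (real n) * (smooth_cdf F (y n) - 1/2)) c < \<epsilon> / 2"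
        using lim by (rule tendstoD) (use \<epsilon> in simp)
      then show "\<forall>\<^sub>F n in sequentially. prob {\<omega> \<in> space M. \<epsilon> \<le> \<bar>U n \<omega> - V n \<omega>\<bar>}
          \<le> 16 * (y n - y0)\<^sup>2 / \<epsilon>\<^sup>2"
        using eventually_gt_at_top[of 0]
      proof eventually_elim
        case (elim n)
        define b where "b = smooth_cdf F (y n) - 1/2"
        define f where "f x = ramp (y n) x - ramp y0 x - b" for x
        have "\<bar>b\<bar> \<le> \<bar>y n - y0\<bar>"
          using smooth_cdf_lipschitz[of F "y n" y0] half by (simp add: b_def)
        \<comment> \<open>One Lipschitz bound for the two ramps and one for their mean
          \<open>b\<close> give the factor 2.\<close>
        then have B: "\<bar>f x\<bar> \<le> 2 * \<bar>y n - y0\<bar>" for x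
          unfolding f_def mult_2
          by (intro order_trans[OF abs_triangle_ineq4] add_mono ramp_lipschitz)
        have mean: "measure_pmf.expectation F f = 0"
          using half by (simp add: f_def[abs_def] smooth_cdf_def b_def)
        have UV: "U n \<omega> - V n \<omega> = (\<Sum>i<n. f (X i \<omega>)) / sqrt (real n) + (sqrt (real n) * b - c)" for \<omega>
        proof -
          have "(\<Sum>i<n. f (X i \<omega>)) = (\<Sum>i<n. 1/2 - ramp y0 (X i \<omega>))
              - (\<Sum>i<n. 1/2 - ramp (y n) (X i \<omega>)) - real n * b"
            by (simp add: f_def sum_subtractf)
          then show ?thesis
            using elim by (simp add: U_def V_def field_simps)
        qed
        have "prob {\<omega> \<in> space M. \<epsilon> \<le> \<bar>U n \<omega> - V n \<omega>\<bar>}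
            \<le> prob {\<omega> \<in> space M. \<epsilon> / 2 * sqrt (real n) \<le> \<bar>\<Sum>i<n. f (X i \<omega>)\<bar>}"
        proof (rule finite_measure_mono, safe)
          fix \<omega> assume "\<epsilon> \<le> \<bar>U n \<omega> - V n \<omega>\<bar>"
          \<comment> \<open>The drift error is below \<epsilon>/2, so the other half must come from
            the fluctuation. With the bound on \<open>f\<close>, Chebyshev's inequality then
            produces the constant 16.\<close>
          then have "\<epsilon> / 2 \<le> \<bar>(\<Sum>i<n. f (X i \<omega>)) / sqrt (real n)\<bar>"
            using elim(1) unfolding UV b_def dist_real_def by linarith
          then show "\<epsilon> / 2 * sqrt (real n) \<le> \<bar>\<Sum>i<n. f (X i \<omega>)\<bar>"
            using elim by (simp add: field_simps)
        qed measurable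
        also have "\<dots> \<le> real n * (2 * \<bar>y n - y0\<bar>)\<^sup>2 / (\<epsilon> / 2 * sqrt (real n))\<^sup>2"
          by (rule prob_sum_ge[OF B mean]) (use elim \<epsilon> in auto)
        also have "\<dots> = 16 * (y n - y0)\<^sup>2 / \<epsilon>\<^sup>2"
          using elim by (simp add: power_mult_distrib power_divide)
        finally show ?case .
      qed
    qed (auto intro: always_eventually)
  qed measurable
  moreover have "\<forall>\<^sub>F n in sequentially. prob {\<omega> \<in> space M. V n \<omega> \<le> c}
      = prob {\<omega> \<in> space M. umed (empirical n (\<lambda>i. X i \<omega>)) \<le> y n}"
    using eventually_gt_at_top[of 0]
  proof eventually_elim
    case (elim n)
    have "V n \<omega> \<le> c \<longleftrightarrow> umed (empirical n (\<lambda>i. X i \<omega>)) \<le> y n" for \<omega>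
      using elim
      by (simp add: V_def umed_le_iff smooth_cdf_empirical sum_subtractf divide_le_0_iff le_divide_eq)
    then show ?case by simp
  qed
  ultimately show ?thesis by (simp cong: tendsto_cong)
qed

text \<open>The estimating equation constrains \<open>T n\<close> only when it is solvable. It is
  solvable, and can be inverted monotonically, while the empirical median lies between its model
  values at \<open>a\<close> and \<open>b\<close>; the complement has vanishing probability. At
  \<open>b\<close> this needs the hypothesis \<open>up\<close>, since to the right of the smallest
  median the smoothed distribution function may stay at 1/2; at \<open>a\<close> strictness is
  automatic.\<close>

lemma umed_estimator_tendsto:
  fixes Q :: "real \<Rightarrow> nat pmf" and T :: "nat \<Rightarrow> 'a \<Rightarrow> real"
  assumes Q: "Q \<theta> = F" and ab: "a < \<theta>" "\<theta> < b" "{a..b} \<subseteq> \<Theta>"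
    and cont: "continuous_on {a..b} (\<lambda>t. umed (Q t))"
    and mono: "strict_mono_on \<Theta> (\<lambda>t. umed (Q t))"
    and up: "1/2 < smooth_cdf F (umed (Q b))"
    and T [measurable]: "\<And>n. T n \<in> borel_measurable M"
    and est: "\<And>n \<omega>. n > 0 \<Longrightarrow> \<omega> \<in> space M \<Longrightarrow>
          \<exists>t\<in>\<Theta>. umed (empirical n (\<lambda>i. X i \<omega>)) = umed (Q t) \<Longrightarrow>
          T n \<omega> \<in> \<Theta> \<and> umed (empirical n (\<lambda>i. X i \<omega>)) = umed (Q (T n \<omega>))"
    and lim: "(\<lambda>n. sqrt (real n) * (smooth_cdf F (umed (Q (\<theta> + s / sqrt (real n)))) - 1/2)) \<longlonglongrightarrow> c"
    and v: "measure_pmf.expectation F (\<lambda>x. (ramp (umed F) x - 1/2)\<^sup>2) = v" "v > 0"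
  shows "(\<lambda>n. cdf (distr M borel (\<lambda>\<omega>. sqrt (real n) * (T n \<omega> - \<theta>))) s)
    \<longlonglongrightarrow> cdf std_normal_distribution (c / sqrt v)"
proof -
  define t where "t n = \<theta> + s / sqrt (real n)" for n
  have t_lim: "t \<longlonglongrightarrow> \<theta>"
    unfolding t_def by real_asymp
  have t_ab: "\<forall>\<^sub>F n in sequentially. t n \<in> {a..b}"
    using order_tendstoD(1)[OF t_lim ab(1)] order_tendstoD(2)[OF t_lim ab(2)]
    by eventually_elim simp
  have y_lim: "(\<lambda>n. umed (Q (t n))) \<longlonglongrightarrow> umed F"
    using continuous_on_tendsto_compose[OF cont t_lim _ t_ab] ab Q by simp
  define p where "p n = prob {\<omega> \<in> space M. umed (empirical n (\<lambda>i. X i \<omega>)) \<le> umed (Q (t n))}" for n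
  define p1 where "p1 n = prob {\<omega> \<in> space M. umed (empirical n (\<lambda>i. X i \<omega>)) \<le> umed (Q a)}" for n
  define p2 where "p2 n = prob {\<omega> \<in> space M. umed (Q b) < umed (empirical n (\<lambda>i. X i \<omega>))}" for n
  define q where "q n = cdf (distr M borel (\<lambda>\<omega>. sqrt (real n) * (T n \<omega> - \<theta>))) s" for n
  have p: "p \<longlonglongrightarrow> cdf std_normal_distribution (c / sqrt v)"
    unfolding p_def
    by (rule prob_umed_empirical_le_tendsto_normal[OF smooth_cdf_umed y_lim lim[folded t_def] v])
  have "umed (Q a) < umed F"
    using strict_mono_onD[OF mono, of a \<theta>] subsetD[OF ab(3), of a] subsetD[OF ab(3), of \<theta>] ab(1,2) Q
    by simp
  then have p1: "p1 \<longlonglongrightarrow> 0"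
    unfolding p1_def by (intro prob_umed_empirical_le_tendsto_0 smooth_cdf_less_half)
  have p2: "p2 \<longlonglongrightarrow> 0"
    unfolding p2_def by (intro prob_umed_empirical_gt_tendsto_0 up)
  have le_events: "{\<omega> \<in> space M. umed (empirical n (\<lambda>i. X i \<omega>)) \<le> y} \<in> events" for n y
    unfolding umed_le_iff by measurable
  have gt_events: "{\<omega> \<in> space M. y < umed (empirical n (\<lambda>i. X i \<omega>))} \<in> events" for n y
    unfolding not_le[symmetric] umed_le_iff by measurable
  have T_events: "{\<omega> \<in> space M. T n \<omega> \<le> y} \<in> events" for n y
    by measurable
  \<comment> \<open>The events behind \<open>p n\<close> and \<open>q n\<close> differ only inside
    the two exceptional events, which gives a sandwich.\<close>
  have "\<forall>\<^sub>F n in sequentially. p n - p1 n - p2 n \<le> q n \<and> q n \<le> p n + p1 n + p2 n"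
    using t_ab eventually_gt_at_top[of 0]
  proof eventually_elim
    case (elim n)
    let ?m = "\<lambda>\<omega>. umed (empirical n (\<lambda>i. X i \<omega>))"
    have q: "q n = prob {\<omega> \<in> space M. T n \<omega> \<le> t n}"
      unfolding q_def cdf_def
      by (subst measure_distr, simp_all, rule arg_cong[of _ _ prob])
         (use elim in \<open>auto simp: t_def field_simps\<close>)
    \<comment> \<open>The intermediate value theorem supplies a solution of the estimating equation
      in the interval, so \<open>T n\<close> is a solution too, and strict monotonicity transfers
      the comparison with \<open>t n\<close>.\<close>
    have key: "T n \<omega> \<le> t n \<longleftrightarrow> ?m \<omega> \<le> umed (Q (t n))"
      if \<omega>: "\<omega> \<in> space M" "umed (Q a) < ?m \<omega>" "?m \<omega> \<le> umed (Q b)" for \<omega>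
    proof -
      obtain u where "a \<le> u" "u \<le> b" "umed (Q u) = ?m \<omega>"
        using IVT'[of "\<lambda>t. umed (Q t)" a "?m \<omega>" b] \<omega> ab cont by auto
      then have "T n \<omega> \<in> \<Theta>" "?m \<omega> = umed (Q (T n \<omega>))"
        using est[of n \<omega>] bexI[of "\<lambda>t. ?m \<omega> = umed (Q t)" u \<Theta>] subsetD[OF ab(3), of u] elim \<omega>(1)
        by auto
      moreover have "t n \<in> \<Theta>" using elim ab by auto
      ultimately show ?thesis
        using strict_mono_on_less_eq[OF mono] by simp
    qed
    define C where "C = {\<omega> \<in> space M. T n \<omega> \<le> t n}"
    define A where "A = {\<omega> \<in> space M. ?m \<omega> \<le> umed (Q (t n))}"
    define A1 where "A1 = {\<omega> \<in> space M. ?m \<omega> \<le> umed (Q a)}"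
    define A2 where "A2 = {\<omega> \<in> space M. umed (Q b) < ?m \<omega>}"
    have ev: "C \<in> events" "A \<in> events" "A1 \<in> events" "A2 \<in> events"
      unfolding C_def A_def A1_def A2_def by (rule T_events le_events gt_events)+
    have key': "\<omega> \<in> A1 \<or> \<omega> \<in> A2 \<or> (\<omega> \<in> C \<longleftrightarrow> \<omega> \<in> A)" if "\<omega> \<in> space M" for \<omega>
      using key[OF that] that unfolding C_def A_def A1_def A2_def
      by (cases "umed (Q a) < ?m \<omega>"; cases "?m \<omega> \<le> umed (Q b)") simp_all
    have "C \<subseteq> A \<union> A1 \<union> A2" "A \<subseteq> C \<union> A1 \<union> A2"
      using key' sets.sets_into_space[OF ev(1)] sets.sets_into_space[OF ev(2)] by blast+
    then have "prob C \<le> prob (A \<union> A1 \<union> A2)" "prob A \<le> prob (C \<union> A1 \<union> A2)"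
      using ev by (auto intro: finite_measure_mono)
    moreover have "prob (B \<union> A1 \<union> A2) \<le> prob B + prob A1 + prob A2" if "B \<in> events" for B
      using measure_Un_le[of "B \<union> A1" M A2] measure_Un_le[of B M A1] that ev by simp
    ultimately have "prob C \<le> prob A + prob A1 + prob A2" "prob A \<le> prob C + prob A1 + prob A2"
      using ev order_trans by blast+
    then show ?case
      unfolding q p_def p1_def p2_def C_def[symmetric] A_def[symmetric] A1_def[symmetric] A2_def[symmetric]
      by simp
  qed
  then have lower: "\<forall>\<^sub>F n in sequentially. p n - p1 n - p2 n \<le> q n"
    and upper: "\<forall>\<^sub>F n in sequentially. q n \<le> p n + p1 n + p2 n"
    by (auto elim: eventually_mono)
  have "q \<longlonglongrightarrow> cdf std_normal_distribution (c / sqrt v)"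
    using tendsto_sandwich[OF lower upper] tendsto_diff[OF tendsto_diff[OF p p1] p2]
      tendsto_add[OF tendsto_add[OF p p1] p2] by simp
  then show ?thesis unfolding q_def[abs_def] .
qed

end

section \<open>Asymptotics of the estimator\<close>

lemma tendsto_difference_quotient_sqrt:
  fixes f :: "real \<Rightarrow> real"
  assumes "(f has_real_derivative D) (at x)"
  shows "(\<lambda>n. sqrt (real n) * (f (x + s / sqrt (real n)) - f x)) \<longlonglongrightarrow> D * s"
\<comment> \<open>The filter \<open>at 0\<close> excludes the point 0, hence the separate
  case.\<close>
proof (cases "s = 0")
  case False
  have lim0: "(\<lambda>n. s / sqrt (real n)) \<longlonglongrightarrow> 0"
    by real_asymp
  have "filterlim (\<lambda>n. s / sqrt (real n)) (at 0) sequentially"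
    unfolding filterlim_at using lim0 False
    by (auto intro!: eventually_mono[OF eventually_gt_at_top[of 0]])
  moreover have "((\<lambda>h. (f (x + h) - f x) / h) \<longlongrightarrow> D) (at 0)"
    using assms by (simp add: DERIV_def)
  ultimately have "(\<lambda>n. (f (x + s / sqrt (real n)) - f x) / (s / sqrt (real n))) \<longlonglongrightarrow> D"
    by (rule filterlim_compose[rotated])
  then have "(\<lambda>n. (f (x + s / sqrt (real n)) - f x) / (s / sqrt (real n)) * s) \<longlonglongrightarrow> D * s"
    by (intro tendsto_intros)
  \<comment> \<open>This holds also for \<open>n = 0\<close>: division by zero gives 0, and both
    sides vanish.\<close>
  moreover have "(f (x + s / sqrt (real n)) - f x) / (s / sqrt (real n)) * s
      = sqrt (real n) * (f (x + s / sqrt (real n)) - f x)" for n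
    using False by simp
  ultimately show ?thesis by simp
qed simp

text \<open>The fraction in \<open>umed\<close>, with the index \<open>k\<close> free. For fixed
  \<open>k\<close> it is differentiable in the parameter wherever the mass at \<open>k\<close> is
  nonzero, even at parameters where \<open>k0\<close> jumps.\<close>

definition median_offset :: "nat \<Rightarrow> nat pmf \<Rightarrow> real" where
  "median_offset k F = (1/2 - dist_fun F (int k - 1)) / pmf F k"

lemma umed_eq_median_offset:
  assumes "dist_fun F (int k - 1) < 1/2" "1/2 \<le> dist_fun F (int k)"
  shows "umed F = real k - 1/2 + median_offset k F"
  using k0_eqI[OF assms] by (simp add: umed_def median_offset_def)

lemma has_derivative_dist_fun:
  assumes "\<And>j::nat. \<exists>D. ((\<lambda>s. pmf (P s) j) has_real_derivative D) (at t)"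
  shows "\<exists>D. ((\<lambda>s. dist_fun (P s) k) has_real_derivative D) (at t)"
proof -
  obtain D where D: "\<And>j. ((\<lambda>s. pmf (P s) j) has_real_derivative D j) (at t)"
    using assms by metis
  show ?thesis
    unfolding dist_fun_eq_sum by (rule exI, rule DERIV_sum, rule D)
qed

lemma has_derivative_median_offset:
  assumes "\<And>j::nat. \<exists>D. ((\<lambda>s. pmf (P s) j) has_real_derivative D) (at t)"
    and "pmf (P t) k \<noteq> 0"
  shows "\<exists>D. ((\<lambda>s. median_offset k (P s)) has_real_derivative D) (at t)"
proof -
  obtain D1 where D1: "((\<lambda>s. pmf (P s) k) has_real_derivative D1) (at t)"
    using assms by blast
  obtain D2 where D2: "((\<lambda>s. dist_fun (P s) (int k - 1)) has_real_derivative D2) (at t)"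
    using has_derivative_dist_fun[OF assms(1)] by blast
  show ?thesis
    unfolding median_offset_def
    by (rule exI, rule DERIV_divide[OF DERIV_diff[OF DERIV_const D2] D1 assms(2)])
qed

text \<open>The end points of \<Theta> may be infinite, so limits at them are taken in the extended
  reals. The empirical median can fall outside the range of \<open>g\<close>, so the estimating
  equation is imposed only where it has a solution. The conditions
  \<open>deriv g \<theta> \<noteq> 0\<close> and \<open>pmf (P \<theta>) (K + 1) \<noteq> 0\<close>
  keep the denominators of the stated limits away from 0: strict monotonicity of \<open>g\<close>
  alone does not exclude a zero derivative.\<close>

theorem theorem4:
  fixes \<Theta> :: "real set"
    and P :: "real \<Rightarrow> nat pmf"
    and \<theta> :: real
    and M :: "'a measure"
    and X :: "nat \<Rightarrow> 'a \<Rightarrow> nat"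
    and T :: "nat \<Rightarrow> 'a \<Rightarrow> real"
    and g :: "real \<Rightarrow> real"
    and K :: nat
  defines "g \<equiv> (\<lambda>t. umed (P t))"
    and "K \<equiv> k0 (P \<theta>)"
  assumes A1: "\<And>x::nat. strict_antimono_on \<Theta> (\<lambda>t. dist_fun (P t) (int x))"
    and A2: "\<And>x::nat. continuous_on \<Theta> (\<lambda>t. dist_fun (P t) (int x))"
    and A3_inf: "\<And>x::nat. x \<noteq> 0 \<Longrightarrow>
          ((\<lambda>t. dist_fun (P (real_of_ereal t)) (int x)) \<longlongrightarrow> 1)
            (at (INF t\<in>\<Theta>. ereal t) within ereal ` \<Theta>)"
    and A3_sup: "\<And>x::nat.
          ((\<lambda>t. dist_fun (P (real_of_ereal t)) (int x)) \<longlongrightarrow> 0)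
            (at (SUP t\<in>\<Theta>. ereal t) within ereal ` \<Theta>)"
    and C1: "\<And>x::nat. \<exists>p'. continuous_on \<Theta> p' \<and>
          (\<forall>t\<in>\<Theta>. ((\<lambda>s. pmf (P s) x) has_real_derivative p' t) (at t within \<Theta>))"
    and theta: "\<theta> \<in> interior \<Theta>"
    and M: "prob_space M"
    and X_indep: "prob_space.indep_vars M (\<lambda>_. count_space UNIV) X UNIV"
    and X_distr: "\<And>i. distr M (count_space UNIV) (X i) = measure_pmf (P \<theta>)"
    and T_measurable: "\<And>n. T n \<in> borel_measurable M"
    and T_estimator: "\<And>n \<omega>. n > 0 \<Longrightarrow> \<omega> \<in> space M \<Longrightarrow>
          \<exists>t\<in>\<Theta>. umed (empirical n (\<lambda>i. X i \<omega>)) = umed (P t) \<Longrightarrow>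
          T n \<omega> \<in> \<Theta> \<and> umed (empirical n (\<lambda>i. X i \<omega>)) = umed (P (T n \<omega>))"
  shows "(dist_fun (P \<theta>) (int K) > 1/2 \<and> deriv g \<theta> \<noteq> 0 \<longrightarrow>
          (let p0 = pmf (P \<theta>) K;
               F1 = dist_fun (P \<theta>) (int K - 1);
               \<sigma>2 = 0.25 / p0 ^ 3 * (4 * F1 * (F1 - 1 + p0) - p0 + 1)
           in weak_conv_m (\<lambda>n. distr M borel (\<lambda>\<omega>. sqrt (real n) * (T n \<omega> - \<theta>)))
                (density lborel (normal_density 0 (sqrt (\<sigma>2 / (deriv g \<theta>)\<^sup>2)))))) \<and>
         (dist_fun (P \<theta>) (int K) = 1/2 \<and> pmf (P \<theta>) (K + 1) \<noteq> 0 \<longrightarrow>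
          (let \<Phi> = cdf std_normal_distribution;
               g'_plus = vector_derivative
                 (\<lambda>t. (1/2 - dist_fun (P t) (int K)) / pmf (P t) (K + 1)) (at_right \<theta>);
               g'_minus = vector_derivative
                 (\<lambda>t. (1/2 - dist_fun (P t) (int K - 1)) / pmf (P t) K) (at_left \<theta>)
           in weak_conv (\<lambda>n. cdf (distr M borel (\<lambda>\<omega>. sqrt (real n) * (T n \<omega> - \<theta>))))
                (\<lambda>t. if t \<le> 0 then \<Phi> (2 * g'_minus * t * pmf (P \<theta>) K)
                     else \<Phi> (2 * g'_plus * t * pmf (P \<theta>) (K + 1)))))"
proof -
  interpret prob_space M by (rule M)
  interpret iid_nat_sample M X "P \<theta>"
    by unfold_locales (use X_indep X_distr in auto)

  \<comment> \<open>Local regularity of the family around \<theta>\<close>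
  define S where "S = interior \<Theta>"
  have S: "open S" "S \<subseteq> \<Theta>" "\<theta> \<in> S"
    using theta by (auto simp: S_def interior_subset)
  \<comment> \<open>At interior points the derivative within \<Theta> is an ordinary two-sided
    derivative.\<close>
  have pmf_deriv: "\<exists>D. ((\<lambda>s. pmf (P s) j) has_real_derivative D) (at t)" if "t \<in> S" for j t
    using C1[of j] that at_within_interior[of t \<Theta>] S(2) by (force simp: S_def)
  note F_deriv = has_derivative_dist_fun[OF pmf_deriv]
  note L_deriv = has_derivative_median_offset[OF pmf_deriv]
  have pmf_cont: "isCont (\<lambda>s. pmf (P s) j) t" if "t \<in> S" for j t
    using pmf_deriv[OF that] DERIV_isCont by blast
  have F_cont: "isCont (\<lambda>s. dist_fun (P s) k) t" if "t \<in> S" for k t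
    using F_deriv[OF that] DERIV_isCont by blast
  have L_cont: "isCont (\<lambda>s. median_offset k (P s)) t" if "t \<in> S" "pmf (P t) k \<noteq> 0" for k t
    using L_deriv[OF that] DERIV_isCont by blast
  have F_anti: "dist_fun (P t) (int x) < dist_fun (P s) (int x)" if "s \<in> \<Theta>" "t \<in> \<Theta>" "s < t" for s t x
    using A1[of x] that by (auto simp: monotone_on_def)
  have mono: "strict_mono_on \<Theta> (\<lambda>t. umed (P t))"
    by (intro strict_mono_onI umed_strict_mono F_anti)
  have ev_S: "\<forall>\<^sub>F t in nhds \<theta>. t \<in> S"
    using S by (simp add: eventually_nhds_in_open)
  have ev_low: "\<forall>\<^sub>F t in nhds \<theta>. dist_fun (P t) k < 1/2" if "dist_fun (P \<theta>) k < 1/2" for k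
    using F_cont[OF S(3), of k] that
    by (intro order_tendstoD) (auto simp: isCont_def tendsto_nhds_iff)
  have ev_up: "\<forall>\<^sub>F t in nhds \<theta>. 1/2 < dist_fun (P t) k" if "1/2 < dist_fun (P \<theta>) k" for k
    using F_cont[OF S(3), of k] that
    by (intro order_tendstoD) (auto simp: isCont_def tendsto_nhds_iff)
  have ev_pos: "\<forall>\<^sub>F t in nhds \<theta>. 0 < pmf (P t) k" if "0 < pmf (P \<theta>) k" for k
    using pmf_cont[OF S(3), of k] that
    by (intro order_tendstoD) (auto simp: isCont_def tendsto_nhds_iff)
  have interval: "\<exists>a b. a < \<theta> \<and> \<theta> < b \<and> (\<forall>t\<in>{a..b}. Q t)" if "\<forall>\<^sub>F t in nhds \<theta>. Q t" for Q
  proof -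
    obtain d where d: "d > 0" "\<And>t. dist t \<theta> < d \<Longrightarrow> Q t"
      using \<open>\<forall>\<^sub>F t in nhds \<theta>. Q t\<close> by (auto simp: eventually_nhds_metric)
    show ?thesis
      by (rule exI[of _ "\<theta> - d / 2"], rule exI[of _ "\<theta> + d / 2"])
         (use d in \<open>auto simp: dist_real_def\<close>)
  qed
  have t_lim: "(\<lambda>n. \<theta> + s / sqrt (real n)) \<longlonglongrightarrow> \<theta>" for s
    by real_asymp
  define p0 where "p0 = pmf (P \<theta>) K"
  define F1 where "F1 = dist_fun (P \<theta>) (int K - 1)"
  have p0: "p0 > 0" using pmf_k0_pos[of "P \<theta>"] by (simp add: p0_def K_def)
  have F1: "F1 < 1/2" using k0_less_half[of "P \<theta>"] by (simp add: F1_def K_def)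
  have F1_p0: "dist_fun (P \<theta>) (int K) = F1 + p0"
    using dist_fun_step[of "P \<theta>" K] by (simp add: F1_def p0_def)
  define L where "L t = median_offset K (P t)" for t
  have L\<theta>: "L \<theta> = (1/2 - F1) / p0"
    by (simp add: L_def median_offset_def F1_def p0_def)
  obtain L' where L': "(L has_real_derivative L') (at \<theta>)"
    using L_deriv[OF S(3), of K] p0 unfolding L_def[abs_def] p0_def by auto
  have L_lim: "(\<lambda>n. sqrt (real n) * (p0 * (L (\<theta> + s / sqrt (real n)) - L \<theta>))) \<longlonglongrightarrow> p0 * L' * s" for s
    using tendsto_mult_left[OF tendsto_difference_quotient_sqrt[OF L', of s], of p0]
    by (simp add: mult_ac)

  \<comment> \<open>Median inside a cell: the normal limit\<close>
  have part_a: "weak_conv_m (\<lambda>n. distr M borel (\<lambda>\<omega>. sqrt (real n) * (T n \<omega> - \<theta>)))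
      (density lborel (normal_density 0 (sqrt (\<sigma>2 / (deriv g \<theta>)\<^sup>2))))"
    if half: "1/2 < dist_fun (P \<theta>) (int K)" and g': "deriv g \<theta> \<noteq> 0"
      and \<sigma>2: "\<sigma>2 = 0.25 / p0 ^ 3 * (4 * F1 * (F1 - 1 + p0) - p0 + 1)" for \<sigma>2
  proof -
    have "\<forall>\<^sub>F t in nhds \<theta>. t \<in> S \<and> dist_fun (P t) (int K - 1) < 1/2 \<and> 1/2 < dist_fun (P t) (int K)
        \<and> 0 < pmf (P t) K"
      using ev_S ev_low[of "int K - 1"] ev_up[OF half] ev_pos[of K] F1 p0
      by (intro eventually_conj) (auto simp: F1_def p0_def)
    from interval[OF this] obtain a b where ab: "a < \<theta>" "\<theta> < b"
      and near: "\<And>t. t \<in> {a..b} \<Longrightarrow> t \<in> S \<and> dist_fun (P t) (int K - 1) < 1/2 \<and> 1/2 < dist_fun (P t) (int K)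
        \<and> 0 < pmf (P t) K"
      by blast
    have g_eq: "umed (P t) = real K - 1/2 + L t" if "t \<in> {a..b}" for t
      using near[OF that] by (auto simp: L_def intro!: umed_eq_median_offset)
    have cell: "real K - 1/2 \<le> umed (P t)" "umed (P t) \<le> real K + 1/2" if "t \<in> {a..b}" for t
      using umed_cell[of "P t"] k0_eqI[of "P t" K] near[OF that] by auto
    have H_eq: "smooth_cdf (P \<theta>) (umed (P t)) = F1 + p0 * L t" if "t \<in> {a..b}" for t
      using smooth_cdf_on_cell[OF cell[OF that], of "P \<theta>"] g_eq[OF that] by (simp add: F1_def p0_def)
    have half_eq: "F1 + p0 * L \<theta> = 1/2"
      using L\<theta> p0 by simp
    have "(g has_real_derivative L') (at \<theta>)"
    proof (rule has_field_derivative_transform_within_open[where S = "{a<..<b}"])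
      show "((\<lambda>t. real K - 1/2 + L t) has_real_derivative L') (at \<theta>)"
        using DERIV_add[OF DERIV_const[of "real K - 1/2"] L'] by simp
    qed (use ab g_eq in \<open>auto simp: g_def\<close>)
    then have deriv_g: "deriv g \<theta> = L'" by (rule DERIV_imp_deriv)
    \<comment> \<open>A negative slope would make \<open>g\<close> decrease just to the right of
      \<theta>, against strict monotonicity; a zero slope is excluded by hypothesis. The choice of
      \<open>h\<close> keeps the witness both within the range of decrease and in
      \<open>{a..b}\<close>.\<close>
    have L'_pos: "L' > 0"
    proof (rule ccontr)
      assume "\<not> L' > 0"
      then have "L' < 0" using g' deriv_g by simp
      then obtain d where d: "d > 0" "\<And>h. 0 < h \<Longrightarrow> h < d \<Longrightarrow> L (\<theta> + h) < L \<theta>"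
        using DERIV_neg_dec_right[OF L'] by auto
      define h where "h = min (d / 2) (b - \<theta>)"
      have h: "0 < h" "h < d" "\<theta> + h \<in> {a..b}" "\<theta> \<in> {a..b}"
        using d(1) ab by (auto simp: h_def)
      then have "umed (P \<theta>) < umed (P (\<theta> + h))"
        using near S(2) by (intro strict_mono_onD[OF mono]) auto
      then show False
        using d(2)[OF h(1,2)] g_eq[OF h(3)] g_eq[OF h(4)] by simp
    qed
    have \<theta>_ab: "\<theta> \<in> {a..b}" "b \<in> {a..b}" "{a..b} \<subseteq> \<Theta>"
      using ab near S(2) by auto
    define v where "v = 1/4 - L \<theta> * (1 - L \<theta>) * p0"
    have v_eq: "measure_pmf.expectation (P \<theta>) (\<lambda>x. (ramp (umed (P \<theta>)) x - 1/2)\<^sup>2) = v"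
      using expectation_ramp_square[OF cell[OF \<theta>_ab(1)], of "P \<theta>"] g_eq[OF \<theta>_ab(1)]
      by (simp add: v_def p0_def)
    \<comment> \<open>At the smaller parameter \<open>a\<close> the distribution function at
      \<open>K\<close> is strictly larger, so at \<theta> it is below 1. This makes the variance
      positive: \<open>L \<theta> * (1 - L \<theta>)\<close> is at most 1/4, so \<open>v\<close> is
      at least \<open>(1 - p0) / 4\<close>.\<close>
    have "p0 < 1"
    proof -
      have "dist_fun (P \<theta>) (int K) < dist_fun (P a) (int K)"
        using near[of a] ab S(2) \<theta>_ab by (intro F_anti) auto
      also have "\<dots> \<le> 1" by (rule dist_fun_le_1)
      finally have "F1 + p0 < 1" using F1_p0 by simp
      moreover have "F1 \<ge> 0" by (simp add: F1_def dist_fun_def)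
      ultimately show ?thesis by simp
    qed
    have "L \<theta> * (1 - L \<theta>) \<le> 1/4"
      using zero_le_power2[of "L \<theta> - 1/2"] by (simp add: power2_eq_square algebra_simps)
    then have "L \<theta> * (1 - L \<theta>) * p0 \<le> 1/4 * p0"
      using p0 by (intro mult_right_mono) auto
    then have v_pos: "v > 0"
      using \<open>p0 < 1\<close> by (simp add: v_def)
    \<comment> \<open>Inserting \<open>L \<theta> = (1/2 - F1) / p0\<close> turns the variance of
      the ramp, divided by \<open>p0\<^sup>2\<close>, into the stated closed form.\<close>
    have \<sigma>2_v: "\<sigma>2 = v / p0\<^sup>2"
      unfolding \<sigma>2 v_def L\<theta> using p0 by (simp add: field_simps power2_eq_square power3_eq_cube)
    have conv: "(\<lambda>n. cdf (distr M borel (\<lambda>\<omega>. sqrt (real n) * (T n \<omega> - \<theta>))) s)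
        \<longlonglongrightarrow> cdf std_normal_distribution (p0 * L' * s / sqrt v)" for s
    proof (rule umed_estimator_tendsto[where Q = P and a = a and b = b and \<Theta> = \<Theta>])
      show "continuous_on {a..b} (\<lambda>t. umed (P t))"
      proof (rule continuous_on_eq[of _ "\<lambda>t. real K - 1/2 + L t"])
        show "continuous_on {a..b} (\<lambda>t. real K - 1/2 + L t)"
        proof (intro continuous_intros continuous_at_imp_continuous_on ballI)
          fix t assume "t \<in> {a..b}"
          then have "t \<in> {a..b}" using ab by simp
          from near[OF this] show "isCont L t"
            unfolding L_def[abs_def] by (intro L_cont) simp_all
        qed
      qed (simp add: g_eq)
      show "1/2 < smooth_cdf (P \<theta>) (umed (P b))"
      proof -
        have "umed (P \<theta>) < umed (P b)"
          using ab \<theta>_ab by (intro strict_mono_onD[OF mono]) auto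
        then have "L \<theta> < L b" using g_eq[OF \<theta>_ab(1)] g_eq[OF \<theta>_ab(2)] by simp
        then have "p0 * L \<theta> < p0 * L b" using p0 by simp
        then show ?thesis using H_eq[OF \<theta>_ab(2)] half_eq by simp
      qed
      have "\<forall>\<^sub>F n in sequentially. \<theta> + s / sqrt (real n) \<in> {a..b}"
        using order_tendstoD(1)[OF t_lim ab(1), of s] order_tendstoD(2)[OF t_lim ab(2), of s]
        by eventually_elim simp
      then have "\<forall>\<^sub>F n in sequentially. sqrt (real n) * (p0 * (L (\<theta> + s / sqrt (real n)) - L \<theta>))
          = sqrt (real n) * (smooth_cdf (P \<theta>) (umed (P (\<theta> + s / sqrt (real n)))) - 1/2)"
      proof eventually_elim
        case (elim n)
        show ?case unfolding H_eq[OF elim] half_eq[symmetric] by (simp add: algebra_simps)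
      qed
      then show "(\<lambda>n. sqrt (real n) * (smooth_cdf (P \<theta>) (umed (P (\<theta> + s / sqrt (real n)))) - 1/2))
          \<longlonglongrightarrow> p0 * L' * s"
        using L_lim by (rule Lim_transform_eventually[rotated])
    qed (fact refl ab \<theta>_ab(3) mono T_measurable T_estimator v_eq v_pos)+
    \<comment> \<open>The drift has slope \<open>p0 * L'\<close>, so dividing \<open>sqrt v\<close>
      by it gives the standard deviation of the limit; the factor \<open>p0\<close> cancels against
      the one in \<open>\<sigma>2\<close>.\<close>
    have \<sigma>: "sqrt (\<sigma>2 / (deriv g \<theta>)\<^sup>2) = sqrt v / (p0 * L')"
      using p0 L'_pos by (simp add: \<sigma>2_v deriv_g real_sqrt_divide real_sqrt_mult)
    have "sqrt v / (p0 * L') > 0"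
      using v_pos p0 L'_pos by simp
    from cdf_centered_normal[OF this] show ?thesis
      unfolding weak_conv_m_def weak_conv_def \<sigma> using conv by (simp add: mult_ac)
  qed

  \<comment> \<open>Median on the boundary of two cells: the two-piece limit\<close>
  have part_b: "weak_conv (\<lambda>n. cdf (distr M borel (\<lambda>\<omega>. sqrt (real n) * (T n \<omega> - \<theta>))))
      (\<lambda>t. if t \<le> 0 then cdf std_normal_distribution (2 * gm * t * pmf (P \<theta>) K)
           else cdf std_normal_distribution (2 * gp * t * pmf (P \<theta>) (K + 1)))"
    if half: "dist_fun (P \<theta>) (int K) = 1/2" and p1_nz: "pmf (P \<theta>) (K + 1) \<noteq> 0"
      and gp: "gp = vector_derivative
                 (\<lambda>t. (1/2 - dist_fun (P t) (int K)) / pmf (P t) (K + 1)) (at_right \<theta>)"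
      and gm: "gm = vector_derivative
                 (\<lambda>t. (1/2 - dist_fun (P t) (int K - 1)) / pmf (P t) K) (at_left \<theta>)" for gp gm
  proof -
    define p1 where "p1 = pmf (P \<theta>) (K + 1)"
    have p1: "p1 > 0" using p1_nz pmf_nonneg[of "P \<theta>" "K + 1"] by (simp add: p1_def)
    \<comment> \<open>The offset in the next cell. It vanishes at \<theta>, which corresponds to the
      left end of that cell, while \<open>L\<close> reaches 1 there.\<close>
    define R where "R t = median_offset (K + 1) (P t)" for t
    have R\<theta>: "R \<theta> = 0"
      using half by (simp add: R_def median_offset_def)
    obtain R' where R': "(R has_real_derivative R') (at \<theta>)"
      using L_deriv[OF S(3), of "K + 1"] p1 unfolding R_def[abs_def] p1_def by auto
    \<comment> \<open>With the index fixed, the quotient has a two-sided derivative at \<theta>, and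
      its one-sided derivative coincides with it, although \<open>g\<close> itself may have a
      kink.\<close>
    have gm_eq: "gm = L'"
    proof -
      have "L = (\<lambda>t. (1/2 - dist_fun (P t) (int K - 1)) / pmf (P t) K)"
        by (simp add: L_def[abs_def] median_offset_def)
      then show ?thesis
        unfolding gm using L'
        by (intro vector_derivative_within)
           (auto simp: has_real_derivative_iff_has_vector_derivative intro: has_vector_derivative_at_within)
    qed
    have gp_eq: "gp = R'"
    proof -
      have "R = (\<lambda>t. (1/2 - dist_fun (P t) (int K)) / pmf (P t) (K + 1))"
        by (simp add: R_def[abs_def] median_offset_def)
      then show ?thesis
        unfolding gp using R'
        by (intro vector_derivative_within)
           (auto simp: has_real_derivative_iff_has_vector_derivative intro: has_vector_derivative_at_within)
    qed
    have half1: "1/2 < dist_fun (P \<theta>) (int (K + 1))"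
      using dist_fun_step[of "P \<theta>" "K + 1"] half p1 by (simp add: p1_def)
    have "\<forall>\<^sub>F t in nhds \<theta>. t \<in> S \<and> dist_fun (P t) (int K - 1) < 1/2 \<and> 1/2 < dist_fun (P t) (int (K + 1))
        \<and> 0 < pmf (P t) K \<and> 0 < pmf (P t) (K + 1)"
      using ev_S ev_low[of "int K - 1"] ev_up[OF half1] ev_pos[of K] ev_pos[of "K + 1"] F1 p0 p1
      by (intro eventually_conj) (auto simp: F1_def p0_def p1_def)
    from interval[OF this] obtain a b where ab: "a < \<theta>" "\<theta> < b"
      and near: "\<And>t. t \<in> {a..b} \<Longrightarrow> t \<in> S \<and> dist_fun (P t) (int K - 1) < 1/2
        \<and> 1/2 < dist_fun (P t) (int (K + 1)) \<and> 0 < pmf (P t) K \<and> 0 < pmf (P t) (K + 1)"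
      by blast
    have \<theta>_ab: "\<theta> \<in> {a..b}" "b \<in> {a..b}" "{a..b} \<subseteq> \<Theta>"
      using ab near S(2) by auto
    \<comment> \<open>Since the distribution function at \<open>K\<close> equals 1/2 at \<theta> and
      strictly decreases in the parameter, \<open>k0\<close> is \<open>K\<close> up to and including
      \<theta> and \<open>K + 1\<close> immediately after it.\<close>
    have left: "dist_fun (P t) (int K - 1) < 1/2" "1/2 \<le> dist_fun (P t) (int K)" if "t \<in> {a..\<theta>}" for t
    proof -
      have t: "t \<in> {a..b}" using that ab by simp
      show "dist_fun (P t) (int K - 1) < 1/2" using near[OF t] by simp
      have "t \<in> \<Theta>" "\<theta> \<in> \<Theta>" using t \<theta>_ab by auto
      then show "1/2 \<le> dist_fun (P t) (int K)"
        using F_anti[of t \<theta> K] half that by (cases "t = \<theta>") auto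
    qed
    have right: "dist_fun (P t) (int (K + 1) - 1) < 1/2" "1/2 \<le> dist_fun (P t) (int (K + 1))"
      if "t \<in> {\<theta><..b}" for t
    proof -
      have t: "t \<in> {a..b}" using that ab by simp
      show "1/2 \<le> dist_fun (P t) (int (K + 1))" using near[OF t] by simp
      have "t \<in> \<Theta>" "\<theta> \<in> \<Theta>" using t \<theta>_ab by auto
      then show "dist_fun (P t) (int (K + 1) - 1) < 1/2"
        using F_anti[of \<theta> t K] half that by simp
    qed
    have g_left: "umed (P t) = real K - 1/2 + L t" if "t \<in> {a..\<theta>}" for t
      unfolding L_def by (rule umed_eq_median_offset[OF left[OF that]])
    have L1: "L \<theta> = 1"
      using L\<theta> half F1_p0 p0 by simp
    have g\<theta>: "umed (P \<theta>) = real K + 1/2"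
      using g_left[of \<theta>] L1 ab by simp
    \<comment> \<open>The formula of the right cell extends to \<theta>: both cells give
      \<open>K + 1/2\<close> there. This overlap is what glues the two continuous pieces of
      \<open>g\<close>.\<close>
    have g_right: "umed (P t) = real (K + 1) - 1/2 + R t" if "t \<in> {\<theta>..b}" for t
    proof (cases "t = \<theta>")
      case True
      then show ?thesis using g\<theta> R\<theta> by simp
    next
      case False
      then show ?thesis
        using that unfolding R_def by (intro umed_eq_median_offset right) auto
    qed
    have H_left: "smooth_cdf (P \<theta>) (umed (P t)) = F1 + p0 * L t" if "t \<in> {a..\<theta>}" for t
    proof -
      have "real K - 1/2 \<le> umed (P t)" "umed (P t) \<le> real K + 1/2"
        using umed_cell[of "P t"] k0_eqI[OF left[OF that]] by auto
      from smooth_cdf_on_cell[OF this, of "P \<theta>"] show ?thesis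
        using g_left[OF that] by (simp add: F1_def p0_def)
    qed
    have H_right: "smooth_cdf (P \<theta>) (umed (P t)) = 1/2 + p1 * R t" if "t \<in> {\<theta>..b}" for t
    proof -
      have cell: "real (K + 1) - 1/2 \<le> umed (P t)" "umed (P t) \<le> real (K + 1) + 1/2"
      proof -
        have "k0 (P t) = K + 1" if "t \<noteq> \<theta>"
          using \<open>t \<in> {\<theta>..b}\<close> that by (intro k0_eqI right) auto
        then show "real (K + 1) - 1/2 \<le> umed (P t)" "umed (P t) \<le> real (K + 1) + 1/2"
          using umed_cell[of "P t"] g\<theta> by (cases "t = \<theta>"; simp)+
      qed
      from smooth_cdf_on_cell[OF cell, of "P \<theta>"] show ?thesis
        using g_right[OF that] half by (simp add: p1_def)
    qed
    have half_eq: "F1 + p0 * L \<theta> = 1/2"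
      using L\<theta> p0 by simp
    \<comment> \<open>At the boundary point the ramp takes only the values 0 and 1, so the variance
      is exactly 1/4.\<close>
    have v_eq: "measure_pmf.expectation (P \<theta>) (\<lambda>x. (ramp (umed (P \<theta>)) x - 1/2)\<^sup>2) = 1/4"
      using expectation_ramp_square[of K "umed (P \<theta>)" "P \<theta>"] by (simp add: g\<theta>)
    have cont: "continuous_on {a..b} (\<lambda>t. umed (P t))"
    proof -
      have "continuous_on {a..\<theta>} (\<lambda>t. umed (P t))"
      proof (rule continuous_on_eq[of _ "\<lambda>t. real K - 1/2 + L t"])
        show "continuous_on {a..\<theta>} (\<lambda>t. real K - 1/2 + L t)"
        proof (intro continuous_intros continuous_at_imp_continuous_on ballI)
          fix t assume "t \<in> {a..\<theta>}"
          then have "t \<in> {a..b}" using ab by simp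
          from near[OF this] show "isCont L t"
            unfolding L_def[abs_def] by (intro L_cont) simp_all
        qed
      qed (simp add: g_left)
      moreover have "continuous_on {\<theta>..b} (\<lambda>t. umed (P t))"
      proof (rule continuous_on_eq[of _ "\<lambda>t. real (K + 1) - 1/2 + R t"])
        show "continuous_on {\<theta>..b} (\<lambda>t. real (K + 1) - 1/2 + R t)"
        proof (intro continuous_intros continuous_at_imp_continuous_on ballI)
          fix t assume "t \<in> {\<theta>..b}"
          then have "t \<in> {a..b}" using ab by simp
          from near[OF this] show "isCont R t"
            unfolding R_def[abs_def] by (intro L_cont) simp_all
        qed
      qed (simp add: g_right)
      ultimately have "continuous_on ({a..\<theta>} \<union> {\<theta>..b}) (\<lambda>t. umed (P t))"
        by (intro continuous_on_closed_Un) auto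
      moreover have "{a..\<theta>} \<union> {\<theta>..b} = {a..b}" using ab by auto
      ultimately show ?thesis by simp
    qed
    \<comment> \<open>Positive mass at \<open>K + 1\<close> makes the smoothed distribution function
      rise above 1/2 right after the boundary.\<close>
    have up: "1/2 < smooth_cdf (P \<theta>) (umed (P b))"
    proof -
      have "umed (P \<theta>) < umed (P b)"
        using ab \<theta>_ab by (intro strict_mono_onD[OF mono]) auto
      then have "R b > 0" using g\<theta> g_right[of b] ab by simp
      then show ?thesis using H_right[of b] ab p1 by simp
    qed
    have conv_left: "(\<lambda>n. cdf (distr M borel (\<lambda>\<omega>. sqrt (real n) * (T n \<omega> - \<theta>))) s)
        \<longlonglongrightarrow> cdf std_normal_distribution (p0 * L' * s / sqrt (1/4))" if "s \<le> 0" for s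
    proof (rule umed_estimator_tendsto[where Q = P and a = a and b = b and \<Theta> = \<Theta>])
      \<comment> \<open>For nonpositive \<open>s\<close> the local parameters approach \<theta> from
        the left, so only the cell of \<open>K\<close> determines the drift.\<close>
      have "\<forall>\<^sub>F n in sequentially. \<theta> + s / sqrt (real n) \<in> {a..\<theta>}"
        using order_tendstoD(1)[OF t_lim ab(1), of s]
        by eventually_elim (use that in \<open>auto simp: divide_nonpos_nonneg\<close>)
      then have "\<forall>\<^sub>F n in sequentially. sqrt (real n) * (p0 * (L (\<theta> + s / sqrt (real n)) - L \<theta>))
          = sqrt (real n) * (smooth_cdf (P \<theta>) (umed (P (\<theta> + s / sqrt (real n)))) - 1/2)"
      proof eventually_elim
        case (elim n)
        show ?case unfolding H_left[OF elim] half_eq[symmetric] by (simp add: algebra_simps)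
      qed
      then show "(\<lambda>n. sqrt (real n) * (smooth_cdf (P \<theta>) (umed (P (\<theta> + s / sqrt (real n)))) - 1/2))
          \<longlonglongrightarrow> p0 * L' * s"
        using L_lim by (rule Lim_transform_eventually[rotated])
    qed (fact refl ab \<theta>_ab(3) cont mono up T_measurable T_estimator v_eq | simp)+
    have conv_right: "(\<lambda>n. cdf (distr M borel (\<lambda>\<omega>. sqrt (real n) * (T n \<omega> - \<theta>))) s)
        \<longlonglongrightarrow> cdf std_normal_distribution (p1 * R' * s / sqrt (1/4))" if "s > 0" for s
    proof (rule umed_estimator_tendsto[where Q = P and a = a and b = b and \<Theta> = \<Theta>])
      have "\<forall>\<^sub>F n in sequentially. \<theta> + s / sqrt (real n) \<in> {\<theta>..b}"
        using order_tendstoD(2)[OF t_lim ab(2), of s]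
        by eventually_elim (use that in auto)
      then have "\<forall>\<^sub>F n in sequentially. p1 * (sqrt (real n) * (R (\<theta> + s / sqrt (real n)) - R \<theta>))
          = sqrt (real n) * (smooth_cdf (P \<theta>) (umed (P (\<theta> + s / sqrt (real n)))) - 1/2)"
      proof eventually_elim
        case (elim n)
        show ?case unfolding H_right[OF elim] R\<theta> by simp
      qed
      moreover have "(\<lambda>n. p1 * (sqrt (real n) * (R (\<theta> + s / sqrt (real n)) - R \<theta>))) \<longlonglongrightarrow> p1 * (R' * s)"
        by (intro tendsto_mult_left tendsto_difference_quotient_sqrt R')
      ultimately show "(\<lambda>n. sqrt (real n) * (smooth_cdf (P \<theta>) (umed (P (\<theta> + s / sqrt (real n)))) - 1/2))
          \<longlonglongrightarrow> p1 * R' * s"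
        by (simp add: Lim_transform_eventually mult.assoc)
    qed (fact refl ab \<theta>_ab(3) cont mono up T_measurable T_estimator v_eq | simp)+
    \<comment> \<open>The standard deviation 1/2 is the source of the factor 2 in the limit.\<close>
    have quarter: "y / sqrt (1/4) = 2 * y" for y :: real
      by (simp add: real_sqrt_divide)
    show ?thesis
      unfolding weak_conv_def gm_eq gp_eq
    proof (intro allI impI)
      fix s :: real
      show "(\<lambda>n. cdf (distr M borel (\<lambda>\<omega>. sqrt (real n) * (T n \<omega> - \<theta>))) s)
          \<longlonglongrightarrow> (if s \<le> 0 then cdf std_normal_distribution (2 * L' * s * pmf (P \<theta>) K)
            else cdf std_normal_distribution (2 * R' * s * pmf (P \<theta>) (K + 1)))"
        using conv_left[of s] conv_right[of s]
        unfolding quarter p0_def p1_def by (cases "s \<le> 0") (simp_all add: mult_ac)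
    qed
  qed

  show ?thesis
    using part_a part_b unfolding Let_def p0_def F1_def by blast
qed

end
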